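(* Let $\zeta\colon\mathbb Z_2\times\mathbb Z_2\to\mathbb C(q)^\times$ be given by $\zeta(\bar{\mathbf i},\bar{\mathbf j})=(-1)^{\bar{\mathbf i}\,\bar{\mathbf j}}$. Then the assignment $l^\pm_{ij}\mapsto l^\pm_{ij}$ for all $i,j$ gives rise to a superalgebra isomorphism $\widetilde U(R)\to U(R)^\zeta$, where $U(R)$ is the general linear RLL superalgebra, $U(R)^\zeta$ its twist by $\zeta$, and $\widetilde U(R)$ the twisted RLL superalgebra.
   Context: Data: $V$ is a complex superspace of dimension $(m,n)$, $N=m+n$, with an ordered homogeneous basis $v_1,\dots,v_N$; $\bar i:=|v_i|$; $(\varepsilon_i,\varepsilon_j)=\delta_{ij}(-1)^{\bar i}$; $V_q=\mathbb C(q)\otimes V$, matrix units $E_{ij}$ of parity $\bar i+\bar j$; $$R=\sum_{i,j}q^{-(\varepsilon_i,\varepsilon_j)}E_{ii}\otimes E_{jj}-(q-q^{-1})\sum_{i<j}(-1)^{\bar j}E_{ij}\otimes E_{ji}\in\mathrm{End}(V_q)^{\otimes2}.$$ Let $\mathcal T$ be the free $\mathbb C(q)$-superalgebra on $l^+_{ij},l^-_{ji}$ ($1\le i\le j\le N$), $|l^\pm_{ij}|=\bar i+\bar j$; put $l^+_{ij}=0=l^-_{ji}$ for $i>j$, $L^\pm_1=\sum l^\pm_{ij}\otimes E_{ij}\otimes\mathrm I$, $L^\pm_2=\sum l^\pm_{ij}\otimes\mathrm I\otimes E_{ij}$, $R_{12}=1\otimes R$. Regard $\mathcal T$ and $\mathrm{End}(V_q)$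 as graded by $G=\mathbb Z_2\times\mathbb Z_2$, with elements of $\mathcal T$ of degree $(|x|,0)$ and elements of $\mathrm{End}(V_q)$ of degree $(0,|X|)$. For a bicharacter $\beta\colon G\times G\to\{\pm1\}$, $A\otimes^\beta B$ denotes $A\otimes B$ with product $(a\otimes b)(a'\otimes b')=\beta(|b|_G,|a'|_G)\,aa'\otimes bb'$ (iterated for several factors). Let $\beta(g,h)=(-1)^{(g_1+g_2)(h_1+h_2)}$ and $\beta'(g,h)=(-1)^{g_1h_1+g_2h_2}$. (Thus $\otimes^\beta$ is the usual tensor product of superalgebras, while with $\beta'$ no sign appears when interchanging an element of $\mathcal T$ with an element of $\mathrm{End}(V_q)$, but the usual sign appears between the two factors $\mathrm{End}(V_q)$.) $U(R)$ is the quotient of $\mathcal T$ by $l^\pm_{ii}l^\mp_{ii}=1$ and all coefficients of $R_{12}L^\pm_1L^\pm_2=L^\pm_2L^\pm_1R_{12}$ and $R_{12}L^+_1L^-_2=L^-_2L^+_1R_{12}$ computed in $\mathcal T\otimes^\beta\mathrm{End}(V_q)^{\otimes2}$. $\widetilde U(R)$ is defined identically (same generators, same diagonal relations, same matrix relations), but with the matrix equations computed in $\mathcal T\otimes^{\beta'}\mathrm{End}(V_q)^{\otimes2}$. For a superalgebra $A$ and a normalized 2-cocycle $\zeta$ on $\mathbb Z_2$, $A^\zeta$ is the superspace $A$ with product $a\cdot_\zeta a'=\zeta(|a|,|a'|)\,aa'$ on homogeneous elements. *)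

theory Defs
  imports
    "HOL-Library.Poly_Mapping"
    "HOL-Library.Z2"
    "HOL-Computational_Algebra.Fraction_Field"
    "HOL-Computational_Algebra.Polynomial"
    "HOL-Algebra.QuotRing"
    "HOL-Algebra.Module"
    "HOL-Algebra.Algebraic_Closure_Type"
begin

text \<open>The field \<open>\<complex>(q)\<close>. The type \<^typ>\<open>bit\<close> plays the role of \<open>\<int>\<^sub>2\<close>.\<close>

type_synonym Cq = "complex poly fract"

definition q :: Cq where
  "q = Fract [:0, 1:] 1"

abbreviation Cq_ring :: "Cq ring" where
  "Cq_ring \<equiv> ring_of_type_algebra"

definition sign_of :: "bit \<Rightarrow> 'a::ring_1" where
  "sign_of x = (if x = 0 then 1 else - 1)"


section \<open>Superalgebras\<close>

record ('k, 'a) superalgebra = "('k, 'a) module" +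
  hcomp :: "bit \<Rightarrow> 'a set"

locale superalgebra = module R A + ring A
  for R :: "('k, 'r) ring_scheme" (structure)
    and A :: "('k, 'a, 'm) superalgebra_scheme" (structure) +
  assumes smult_mult_left: "\<lbrakk>c \<in> carrier R; x \<in> carrier A; y \<in> carrier A\<rbrakk> \<Longrightarrow>
      (c \<odot>\<^bsub>A\<^esub> x) \<otimes>\<^bsub>A\<^esub> y = c \<odot>\<^bsub>A\<^esub> (x \<otimes>\<^bsub>A\<^esub> y)"
    and smult_mult_right: "\<lbrakk>c \<in> carrier R; x \<in> carrier A; y \<in> carrier A\<rbrakk> \<Longrightarrow>
      x \<otimes>\<^bsub>A\<^esub> (c \<odot>\<^bsub>A\<^esub> y) = c \<odot>\<^bsub>A\<^esub> (x \<otimes>\<^bsub>A\<^esub> y)"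
    and hcomp_submodule: "submodule (hcomp A s) R A"
    and hcomp_direct_sum: "x \<in> carrier A \<Longrightarrow>
      \<exists>!(y, z). y \<in> hcomp A 0 \<and> z \<in> hcomp A 1 \<and> x = y \<oplus>\<^bsub>A\<^esub> z"
    and hcomp_mult: "\<lbrakk>x \<in> hcomp A s; y \<in> hcomp A t\<rbrakk> \<Longrightarrow> x \<otimes>\<^bsub>A\<^esub> y \<in> hcomp A (s + t)"

text \<open>The homogeneous part of degree \<open>s\<close> of an element.\<close>

definition hpart :: "('k, 'a, 'm) superalgebra_scheme \<Rightarrow> bit \<Rightarrow> 'a \<Rightarrow> 'a" where
  "hpart A s x = (THE y. y \<in> hcomp A s \<and> (\<exists>z \<in> hcomp A (s + 1). x = y \<oplus>\<^bsub>A\<^esub> z))"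

text \<open>The twist \<open>A\<^sup>\<zeta>\<close>: the product \<open>\<zeta>(|a|,|b|) a b\<close> of homogeneous elements, extended biadditively.\<close>

definition twist :: "(bit \<Rightarrow> bit \<Rightarrow> 'k) \<Rightarrow> ('k, 'a) superalgebra \<Rightarrow> ('k, 'a) superalgebra" where
  "twist \<zeta> A = A\<lparr>monoid.mult := (\<lambda>a b. \<Oplus>\<^bsub>A\<^esub>s \<in> {0, 1}. \<Oplus>\<^bsub>A\<^esub>t \<in> {0, 1}.
      \<zeta> s t \<odot>\<^bsub>A\<^esub> (hpart A s a \<otimes>\<^bsub>A\<^esub> hpart A t b))\<rparr>"

definition quot_superalgebra ::
    "('k, 'a) superalgebra \<Rightarrow> 'a set \<Rightarrow> ('k, 'a set) superalgebra" where
  "quot_superalgebra A I =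
     \<lparr>carrier = carrier (A Quot I), monoid.mult = monoid.mult (A Quot I), one = one (A Quot I),
      zero = zero (A Quot I), add = add (A Quot I),
      module.smult = (\<lambda>c S. \<Union>x \<in> S. I +>\<^bsub>A\<^esub> (c \<odot>\<^bsub>A\<^esub> x)),
      hcomp = (\<lambda>s. (\<lambda>x. I +>\<^bsub>A\<^esub> x) ` hcomp A s)\<rparr>"

definition superalgebra_iso ::
    "'k ring \<Rightarrow> ('k, 'a) superalgebra \<Rightarrow> ('k, 'b) superalgebra \<Rightarrow> ('a \<Rightarrow> 'b) set" where
  "superalgebra_iso R A B =
     {f. superalgebra R A \<and> superalgebra R B \<and>
         f \<in> ring_hom A B \<and> bij_betw f (carrier A) (carrier B) \<and>
         (\<forall>c \<in> carrier R. \<forall>x \<in> carrier A. f (c \<odot>\<^bsub>A\<^esub> x) = c \<odot>\<^bsub>B\<^esub> f x) \<and>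
         (\<forall>s. f ` hcomp A s \<subseteq> hcomp B s)}"


section \<open>Free superalgebras\<close>

text \<open>
  Words under concatenation form the free monoid, written additively so that the convolution
  product of \<^theory>\<open>HOL-Library.Poly_Mapping\<close> is the product of noncommutative polynomials.
\<close>

datatype 'x free_monoid = Word (letters: "'x list")

instantiation free_monoid :: (type) monoid_add
begin

definition zero_free_monoid :: "'x free_monoid" where
  "zero_free_monoid = Word []"

definition plus_free_monoid :: "'x free_monoid \<Rightarrow> 'x free_monoid \<Rightarrow> 'x free_monoid" where
  "plus_free_monoid v w = Word (letters v @ letters w)"

instance
  by standard (simp_all add: zero_free_monoid_def plus_free_monoid_def)

end

type_synonym 'x ncpoly = "'x free_monoid \<Rightarrow>\<^sub>0 Cq"

definition nc_const :: "Cq \<Rightarrow> 'x ncpoly" where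
  "nc_const c = Poly_Mapping.single 0 c"

definition nc_var :: "'x \<Rightarrow> 'x ncpoly" where
  "nc_var x = Poly_Mapping.single (Word [x]) 1"

definition word_deg :: "('x \<Rightarrow> bit) \<Rightarrow> 'x free_monoid \<Rightarrow> bit" where
  "word_deg d w = sum_list (map d (letters w))"

definition nc_part :: "('x \<Rightarrow> bit) \<Rightarrow> bit \<Rightarrow> 'x ncpoly \<Rightarrow> 'x ncpoly" where
  "nc_part d s f = (\<Sum>w \<in> {w \<in> Poly_Mapping.keys f. word_deg d w = s}.
     Poly_Mapping.single w (Poly_Mapping.lookup f w))"

text \<open>The free \<open>\<complex>(q)\<close>-superalgebra on the generators \<open>x \<in> B\<close>, where \<open>x\<close> has parity \<open>d x\<close>.\<close>

definition free_superalgebra :: "'x set \<Rightarrow> ('x \<Rightarrow> bit) \<Rightarrow> (Cq, 'x ncpoly) superalgebra" where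
  "free_superalgebra B d =
     \<lparr>carrier = {f. \<forall>w \<in> Poly_Mapping.keys f. set (letters w) \<subseteq> B},
      monoid.mult = (*), one = 1, zero = 0, add = (+),
      module.smult = (\<lambda>c f. nc_const c * f),
      hcomp = (\<lambda>s. {f. \<forall>w \<in> Poly_Mapping.keys f. set (letters w) \<subseteq> B \<and> word_deg d w = s})\<rparr>"


section \<open>The RLL superalgebras\<close>

text \<open>
  Throughout, \<open>V\<close> has the ordered basis \<open>v\<^sub>1, \<dots>, v\<^sub>N\<close> and \<open>par i\<close> is the parity of \<open>v\<^sub>i\<close>.
  The letter \<open>L Plus i j\<close> stands for \<open>l\<^sup>+\<^sub>i\<^sub>j\<close>, and \<open>L Minus i j\<close> for \<open>l\<^sup>-\<^sub>i\<^sub>j\<close>.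
\<close>

datatype pm = Plus | Minus

datatype RLL_letter = L pm nat nat

definition RLL_letters :: "nat \<Rightarrow> RLL_letter set" where
  "RLL_letters N = {L Plus i j | i j. 1 \<le> i \<and> i \<le> j \<and> j \<le> N}
     \<union> {L Minus j i | i j. 1 \<le> i \<and> i \<le> j \<and> j \<le> N}"

fun letter_par :: "(nat \<Rightarrow> bit) \<Rightarrow> RLL_letter \<Rightarrow> bit" where
  "letter_par par (L e i j) = par i + par j"

definition free_RLL :: "nat \<Rightarrow> (nat \<Rightarrow> bit) \<Rightarrow> (Cq, RLL_letter ncpoly) superalgebra" where
  "free_RLL N par = free_superalgebra (RLL_letters N) (letter_par par)"

definition l_gen :: "nat \<Rightarrow> pm \<Rightarrow> nat \<Rightarrow> nat \<Rightarrow> RLL_letter ncpoly" where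
  "l_gen N e i j = (if L e i j \<in> RLL_letters N then nc_var (L e i j) else 0)"

text \<open>
  An element \<open>\<Sum> x\<^sub>i\<^sub>j\<^sub>k\<^sub>l \<otimes> E\<^sub>i\<^sub>j \<otimes> E\<^sub>k\<^sub>l\<close> of \<open>\<T> \<otimes> End(V\<^sub>q)\<^sup>\<otimes>\<^sup>2\<close> is represented by its coefficient function,
  of which only the values at \<open>i, j, k, l \<in> {1..N}\<close> matter.
\<close>

type_synonym 'a tens = "nat \<Rightarrow> nat \<Rightarrow> nat \<Rightarrow> nat \<Rightarrow> 'a"

definition eps_form :: "(nat \<Rightarrow> bit) \<Rightarrow> nat \<Rightarrow> nat \<Rightarrow> int" where
  "eps_form par i j = (if i = j then sign_of (par i) else 0)"

definition R_matrix :: "(nat \<Rightarrow> bit) \<Rightarrow> Cq tens" where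
  "R_matrix par i j k l =
     (if i = j \<and> k = l then q powi (- eps_form par i k) else 0)
     - (if i < j \<and> k = j \<and> l = i then (q - inverse q) * sign_of (par j) else 0)"

definition R12 :: "(nat \<Rightarrow> bit) \<Rightarrow> RLL_letter ncpoly tens" where
  "R12 par i j k l = nc_const (R_matrix par i j k l)"

definition L1 :: "nat \<Rightarrow> pm \<Rightarrow> RLL_letter ncpoly tens" where
  "L1 N e i j k l = (if k = l then l_gen N e i j else 0)"

definition L2 :: "nat \<Rightarrow> pm \<Rightarrow> RLL_letter ncpoly tens" where
  "L2 N e i j k l = (if i = j then l_gen N e k l else 0)"

type_synonym bichar = "bit \<times> bit \<Rightarrow> bit \<times> bit \<Rightarrow> int"

definition beta :: bichar where
  "beta g h = sign_of ((fst g + snd g) * (fst h + snd h))"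

definition beta' :: bichar where
  "beta' g h = sign_of (fst g * fst h + snd g * snd h)"

text \<open>
  The product of \<open>\<T> \<otimes>\<^sup>\<beta> End(V\<^sub>q) \<otimes>\<^sup>\<beta> End(V\<^sub>q)\<close>. For \<open>a'\<close> homogeneous,
  \<open>(a \<otimes> X \<otimes> Y) (a' \<otimes> X' \<otimes> Y') = \<beta>(|X|,|a'|) \<beta>(|Y|,|a'|) \<beta>(|Y|,|X'|) a a' \<otimes> X X' \<otimes> Y Y'\<close>,
  where \<open>|a'|\<close> is of the form \<open>(s, 0)\<close> and \<open>|E\<^sub>i\<^sub>j|\<close> is \<open>(0, par i + par j)\<close>. Below, \<open>X = E\<^sub>i\<^sub>u\<close>,
  \<open>X' = E\<^sub>u\<^sub>j\<close>, \<open>Y = E\<^sub>k\<^sub>v\<close>, \<open>Y' = E\<^sub>v\<^sub>l\<close>, and \<open>a'\<close> is the degree \<open>s\<close> part of the coefficient of \<open>X' \<otimes> Y'\<close>.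
\<close>

definition E_deg :: "(nat \<Rightarrow> bit) \<Rightarrow> nat \<Rightarrow> nat \<Rightarrow> bit \<times> bit" where
  "E_deg par i j = (0, par i + par j)"

definition tens_mult :: "bichar \<Rightarrow> nat \<Rightarrow> (nat \<Rightarrow> bit) \<Rightarrow>
    RLL_letter ncpoly tens \<Rightarrow> RLL_letter ncpoly tens \<Rightarrow> RLL_letter ncpoly tens" where
  "tens_mult \<beta> N par x y i j k l =
     (\<Sum>u = 1..N. \<Sum>v = 1..N. \<Sum>s \<in> {0, 1}.
        of_int (\<beta> (E_deg par i u) (s, 0) * \<beta> (E_deg par k v) (s, 0)
          * \<beta> (E_deg par k v) (E_deg par u j))
        * (x i u k v * nc_part (letter_par par) s (y u j v l)))"

definition RLL_relations :: "bichar \<Rightarrow> nat \<Rightarrow> (nat \<Rightarrow> bit) \<Rightarrow> RLL_letter ncpoly set" where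
  "RLL_relations \<beta> N par =
     {l_gen N Plus i i * l_gen N Minus i i - 1 | i. i \<in> {1..N}}
     \<union> {l_gen N Minus i i * l_gen N Plus i i - 1 | i. i \<in> {1..N}}
     \<union> {tens_mult \<beta> N par (tens_mult \<beta> N par (R12 par) (L1 N e)) (L2 N e') i j k l
          - tens_mult \<beta> N par (tens_mult \<beta> N par (L2 N e') (L1 N e)) (R12 par) i j k l
        | e e' i j k l. (e, e') \<in> {(Plus, Plus), (Minus, Minus), (Plus, Minus)}
            \<and> {i, j, k, l} \<subseteq> {1..N}}"

definition RLL_ideal :: "bichar \<Rightarrow> nat \<Rightarrow> (nat \<Rightarrow> bit) \<Rightarrow> RLL_letter ncpoly set" where
  "RLL_ideal \<beta> N par = Idl\<^bsub>free_RLL N par\<^esub> (RLL_relations \<beta> N par)"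

definition RLL :: "bichar \<Rightarrow> nat \<Rightarrow> (nat \<Rightarrow> bit) \<Rightarrow> (Cq, RLL_letter ncpoly set) superalgebra" where
  "RLL \<beta> N par = quot_superalgebra (free_RLL N par) (RLL_ideal \<beta> N par)"

definition RLL_gen :: "bichar \<Rightarrow> nat \<Rightarrow> (nat \<Rightarrow> bit) \<Rightarrow> pm \<Rightarrow> nat \<Rightarrow> nat \<Rightarrow> RLL_letter ncpoly set" where
  "RLL_gen \<beta> N par e i j = RLL_ideal \<beta> N par +>\<^bsub>free_RLL N par\<^esub> l_gen N e i j"

abbreviation U_R :: "nat \<Rightarrow> (nat \<Rightarrow> bit) \<Rightarrow> (Cq, RLL_letter ncpoly set) superalgebra" where
  "U_R \<equiv> RLL beta"

abbreviation U_R_tilde :: "nat \<Rightarrow> (nat \<Rightarrow> bit) \<Rightarrow> (Cq, RLL_letter ncpoly set) superalgebra" where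
  "U_R_tilde \<equiv> RLL beta'"

end

theory Submission
  imports Defs
begin

text \<open>
  A word \<open>x\<^sub>1 \<dots> x\<^sub>r\<close> in homogeneous letters has a Koszul sign, the product of the signs
  \<open>(-1)\<close> to the \<open>|x\<^sub>a| |x\<^sub>b|\<close> over all \<open>a < b\<close>. It is exactly the sign that appears when the
  letters are multiplied with the twisted product of \<open>\<T>\<^sup>\<zeta>\<close> instead of the concatenation product.
  So rescaling every word by its Koszul sign is an isomorphism \<open>K\<close> from the free superalgebra \<open>\<T>\<close>
  onto its twist \<open>\<T>\<^sup>\<zeta>\<close> that fixes the generators (\<open>koszul_map_iso\<close>). It remains to see that \<open>K\<close>
  carries the ideal of relations computed with \<open>\<beta>'\<close> onto the one computed with \<open>\<beta>\<close>.

  The key is a computation in \<open>\<T> \<otimes> End(V)\<^sup>\<otimes>\<^sup>2\<close>. Call a tensor even if its coefficient at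
  \<open>E\<^sub>i\<^sub>j \<otimes> E\<^sub>k\<^sub>l\<close> has the parity of \<open>E\<^sub>i\<^sub>j \<otimes> E\<^sub>k\<^sub>l\<close>. In a product of even tensors, moving
  the matrix part \<open>X \<otimes> Y\<close> of the first factor past the coefficient \<open>a'\<close> of the second one costs
  the sign \<open>(-1)\<close> to the \<open>(|X| + |Y|) |a'|\<close> for \<open>\<beta>\<close>, and no sign for \<open>\<beta>'\<close>. By evenness
  \<open>|X| + |Y|\<close> is the parity of the coefficient \<open>a\<close> of the first factor, so the discrepancy is
  \<open>(-1)\<close> to the \<open>|a| |a'|\<close>, which is what \<open>K\<close> produces on \<open>a a'\<close>. Hence \<open>K\<close>, applied to the
  coefficients, turns \<open>\<beta>'\<close>-products of even tensors into \<open>\<beta>\<close>-products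
  (\<open>koszul_related_tens_mult\<close>). The tensors \<open>R\<close>, \<open>L\<^sub>1\<close> and \<open>L\<^sub>2\<close> are even and fixed by \<open>K\<close>, and
  therefore \<open>K\<close> sends each defining relation of the one superalgebra to the corresponding relation
  of the other (\<open>koszul_map_RLL_relations\<close>).

  The passage to quotients is general. The relations are homogeneous, so they generate a homogeneous
  ideal, and homogeneous ideals of a superalgebra and of its twist are the same because the two
  products of homogeneous elements differ by units. Thus an isomorphism onto a twist descends to
  quotients by corresponding homogeneous relations (\<open>quotient_twist_iso\<close>).
\<close>

text \<open>
  By default the simplifier replaces addition and multiplication in \<open>\<int>\<^sub>2\<close> by bitwise operations,
  which hides the ring structure on which all parity computations below depend.
\<close>

declare add_bit_eq_xor [simp del] mult_bit_eq_and [simp del]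

lemma bit_cancel: "(a::bit) + b + b = a" "b + b = (0::bit)"
  by (cases a; cases b; simp)+

section \<open>Homogeneous parts\<close>

context superalgebra
begin

lemma hcomp_closed [intro]:
  "x \<in> hcomp A s \<Longrightarrow> x \<in> carrier A"
  using submoduleE(1)[OF hcomp_submodule] by blast

lemma hcomp_zero [simp]: "\<zero>\<^bsub>A\<^esub> \<in> hcomp A s"
  using subgroup.one_closed[OF submodule.axioms(1)[OF hcomp_submodule]] by simp

lemma hcomp_add [intro]:
  "\<lbrakk>x \<in> hcomp A s; y \<in> hcomp A s\<rbrakk> \<Longrightarrow> x \<oplus>\<^bsub>A\<^esub> y \<in> hcomp A s"
  by (rule submoduleE(5)[OF hcomp_submodule])

lemma hcomp_smult [intro]:
  "\<lbrakk>c \<in> carrier R; x \<in> hcomp A s\<rbrakk> \<Longrightarrow> c \<odot>\<^bsub>A\<^esub> x \<in> hcomp A s"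
  by (rule submoduleE(4)[OF hcomp_submodule])

text \<open>
  The axiom speaks of degrees 0 and 1 in this order. The form for degrees \<open>s\<close> and \<open>s + 1\<close> spares
  case distinctions in all later arguments.
\<close>

lemma hcomp_decomposition_unique:
  assumes "y \<in> hcomp A s" "y' \<in> hcomp A s" "z \<in> hcomp A (s + 1)" "z' \<in> hcomp A (s + 1)"
    and eq: "y \<oplus>\<^bsub>A\<^esub> z = y' \<oplus>\<^bsub>A\<^esub> z'"
  shows "y = y' \<and> z = z'"
proof -
  have unique: "u = u' \<and> w = w'"
    if "u \<in> hcomp A 0" "w \<in> hcomp A 1" "u' \<in> hcomp A 0" "w' \<in> hcomp A 1"
      "u \<oplus>\<^bsub>A\<^esub> w = u' \<oplus>\<^bsub>A\<^esub> w'" for u w u' w'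
  proof -
    let ?P = "\<lambda>(a, b). a \<in> hcomp A 0 \<and> b \<in> hcomp A 1 \<and> u \<oplus>\<^bsub>A\<^esub> w = a \<oplus>\<^bsub>A\<^esub> b"
    have "u \<oplus>\<^bsub>A\<^esub> w \<in> carrier A" using that by blast
    then have "\<exists>!p. ?P p" by (rule hcomp_direct_sum)
    moreover have "?P (u, w)" "?P (u', w')" using that by simp_all
    ultimately have "(u, w) = (u', w')" by blast
    then show ?thesis by simp
  qed
  have swap: "z \<oplus>\<^bsub>A\<^esub> y = z' \<oplus>\<^bsub>A\<^esub> y'"
    using assms hcomp_closed by (simp add: M.a_comm)
  show ?thesis
  proof (cases "s = 0")
    case True
    then show ?thesis using unique[of y z y' z'] assms by simp
  next
    case False
    then show ?thesis using unique[of z y z' y'] assms swap by simp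
  qed
qed

lemma hpartI:
  assumes "y \<in> hcomp A s" "z \<in> hcomp A (s + 1)" "x = y \<oplus>\<^bsub>A\<^esub> z"
  shows "hpart A s x = y"
  unfolding hpart_def
  by (rule the_equality) (use assms hcomp_decomposition_unique in blast)+

lemma hpart_decomposition:
  assumes x: "x \<in> carrier A"
  shows "hpart A s x \<in> hcomp A s" "x = hpart A s x \<oplus>\<^bsub>A\<^esub> hpart A (s + 1) x"
proof -
  obtain y z where yz: "y \<in> hcomp A 0" "z \<in> hcomp A 1" "x = y \<oplus>\<^bsub>A\<^esub> z"
    using hcomp_direct_sum[OF x] by auto
  have "x = z \<oplus>\<^bsub>A\<^esub> y" using yz M.a_comm hcomp_closed by metis
  then have eq: "hpart A 0 x = y" "hpart A 1 x = z"
    using hpartI[of y 0 z x] hpartI[of z 1 y x] yz by simp_all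
  show "hpart A s x \<in> hcomp A s" "x = hpart A s x \<oplus>\<^bsub>A\<^esub> hpart A (s + 1) x"
    using yz eq \<open>x = z \<oplus>\<^bsub>A\<^esub> y\<close> by (cases s; simp)+
qed

lemma hpart_closed [simp]: "x \<in> carrier A \<Longrightarrow> hpart A s x \<in> carrier A"
  using hpart_decomposition(1) by blast

lemma hpart_homogeneous:
  assumes "x \<in> hcomp A t"
  shows "hpart A s x = (if s = t then x else \<zero>\<^bsub>A\<^esub>)"
proof (cases "s = t")
  case True
  then show ?thesis using hpartI[of x s "\<zero>\<^bsub>A\<^esub>" x] assms hcomp_closed by auto
next
  case False
  then have "t = s + 1" by (cases s; cases t) simp_all
  then show ?thesis using hpartI[of "\<zero>\<^bsub>A\<^esub>" s x x] assms False hcomp_closed by auto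
qed

lemma hpart_add:
  assumes "x \<in> carrier A" "y \<in> carrier A"
  shows "hpart A s (x \<oplus>\<^bsub>A\<^esub> y) = hpart A s x \<oplus>\<^bsub>A\<^esub> hpart A s y"
proof (rule hpartI)
  let ?h = "hpart A"
  show "x \<oplus>\<^bsub>A\<^esub> y
      = (?h s x \<oplus>\<^bsub>A\<^esub> ?h s y) \<oplus>\<^bsub>A\<^esub> (?h (s + 1) x \<oplus>\<^bsub>A\<^esub> ?h (s + 1) y)" (is "_ = ?r")
  proof -
    have "x \<oplus>\<^bsub>A\<^esub> y = (?h s x \<oplus>\<^bsub>A\<^esub> ?h (s + 1) x) \<oplus>\<^bsub>A\<^esub> (?h s y \<oplus>\<^bsub>A\<^esub> ?h (s + 1) y)"
      using hpart_decomposition(2) assms by simp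
    also have "\<dots> = ?r"
      using assms by (simp add: M.a_ac)
    finally show ?thesis .
  qed
qed (use assms hpart_decomposition in blast)+

lemma hpart_zero [simp]: "hpart A s \<zero>\<^bsub>A\<^esub> = \<zero>\<^bsub>A\<^esub>"
  using hpart_homogeneous[OF hcomp_zero[of s], of s] by simp

lemma hpart_smult:
  assumes "c \<in> carrier R" "x \<in> carrier A"
  shows "hpart A s (c \<odot>\<^bsub>A\<^esub> x) = c \<odot>\<^bsub>A\<^esub> hpart A s x"
proof (rule hpartI)
  show "c \<odot>\<^bsub>A\<^esub> x = c \<odot>\<^bsub>A\<^esub> hpart A s x \<oplus>\<^bsub>A\<^esub> c \<odot>\<^bsub>A\<^esub> hpart A (s + 1) x"
    using assms hpart_decomposition(2)[of x s] smult_r_distr[of c "hpart A s x" "hpart A (s + 1) x"]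
    by simp
qed (use assms hpart_decomposition in blast)+

text \<open>Additive properties, such as multilinear identities, need only be checked in each degree.\<close>

lemma homogeneous_induct [consumes 1, case_names homogeneous add]:
  assumes "x \<in> carrier A"
    and hom: "\<And>s x. x \<in> hcomp A s \<Longrightarrow> P x"
    and add: "\<And>x y. \<lbrakk>x \<in> carrier A; y \<in> carrier A; P x; P y\<rbrakk> \<Longrightarrow> P (x \<oplus>\<^bsub>A\<^esub> y)"
  shows "P x"
  using hpart_decomposition[OF assms(1)] hom add hcomp_closed by metis

lemma one_even: "\<one>\<^bsub>A\<^esub> \<in> hcomp A 0"
proof -
  define e where "e s = hpart A s \<one>\<^bsub>A\<^esub>" for s
  have e: "e s \<in> hcomp A s" "e s \<in> carrier A" "\<one>\<^bsub>A\<^esub> = e 0 \<oplus>\<^bsub>A\<^esub> e 1" for s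
    using hpart_decomposition[OF one_closed] hpart_decomposition(2)[OF one_closed, of 0]
    unfolding e_def by auto
  \<comment> \<open>Comparing degrees in \<open>x = x e\<^sub>0 + x e\<^sub>1\<close> shows that \<open>e\<^sub>1\<close> annihilates homogeneous elements.\<close>
  have annih: "x \<otimes>\<^bsub>A\<^esub> e 1 = \<zero>\<^bsub>A\<^esub>" if x: "x \<in> hcomp A s" for x s
  proof -
    have xc: "x \<in> carrier A" using x by blast
    have "x \<oplus>\<^bsub>A\<^esub> \<zero>\<^bsub>A\<^esub> = x \<otimes>\<^bsub>A\<^esub> (e 0 \<oplus>\<^bsub>A\<^esub> e 1)"
      using xc r_one[OF xc] by (simp only: e(3)[symmetric] M.r_zero)
    also have "\<dots> = x \<otimes>\<^bsub>A\<^esub> e 0 \<oplus>\<^bsub>A\<^esub> x \<otimes>\<^bsub>A\<^esub> e 1"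
      using xc e(2) r_distr by blast
    finally have "x \<oplus>\<^bsub>A\<^esub> \<zero>\<^bsub>A\<^esub> = x \<otimes>\<^bsub>A\<^esub> e 0 \<oplus>\<^bsub>A\<^esub> x \<otimes>\<^bsub>A\<^esub> e 1" .
    from hcomp_decomposition_unique[OF x _ _ _ this]
    show ?thesis using hcomp_mult[OF x e(1)[of 0]] hcomp_mult[OF x e(1)[of 1]] by simp
  qed
  have "e 1 = (e 0 \<oplus>\<^bsub>A\<^esub> e 1) \<otimes>\<^bsub>A\<^esub> e 1" using l_one[OF e(2)[of 1]] by (simp only: e(3)[symmetric])
  also have "\<dots> = e 0 \<otimes>\<^bsub>A\<^esub> e 1 \<oplus>\<^bsub>A\<^esub> e 1 \<otimes>\<^bsub>A\<^esub> e 1" by (simp add: l_distr e(2))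
  also have "\<dots> = \<zero>\<^bsub>A\<^esub>" using annih[OF e(1)[of 0]] annih[OF e(1)[of 1]] by simp
  finally show ?thesis using e(1)[of 0] e(2)[of 0] e(3) by simp
qed

text \<open>The degrees are \<open>s - t\<close>, written as \<open>s + t\<close> since signs do not matter in \<open>\<int>\<^sub>2\<close>.\<close>

lemma hpart_mult_homogeneous_right:
  assumes "x \<in> carrier A" "y \<in> hcomp A t"
  shows "hpart A s (x \<otimes>\<^bsub>A\<^esub> y) = hpart A (s + t) x \<otimes>\<^bsub>A\<^esub> y"
proof (rule hpartI)
  have y: "y \<in> carrier A" using assms by blast
  show "x \<otimes>\<^bsub>A\<^esub> y = hpart A (s + t) x \<otimes>\<^bsub>A\<^esub> y \<oplus>\<^bsub>A\<^esub> hpart A (s + t + 1) x \<otimes>\<^bsub>A\<^esub> y"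
    using assms y hpart_decomposition(2)[of x "s + t"] l_distr[of "hpart A (s + t) x" "hpart A (s + t + 1) x" y]
    by simp
  show "hpart A (s + t) x \<otimes>\<^bsub>A\<^esub> y \<in> hcomp A s"
    using hcomp_mult[OF hpart_decomposition(1)[OF assms(1), of "s + t"] assms(2)]
    by (simp add: bit_cancel)
  show "hpart A (s + t + 1) x \<otimes>\<^bsub>A\<^esub> y \<in> hcomp A (s + 1)"
    using hcomp_mult[OF hpart_decomposition(1)[OF assms(1), of "s + t + 1"] assms(2)]
    by (cases s; cases t) simp_all
qed

lemma hpart_mult_homogeneous_left:
  assumes "x \<in> hcomp A t" "y \<in> carrier A"
  shows "hpart A s (x \<otimes>\<^bsub>A\<^esub> y) = x \<otimes>\<^bsub>A\<^esub> hpart A (s + t) y"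
proof (rule hpartI)
  have x: "x \<in> carrier A" using assms by blast
  show "x \<otimes>\<^bsub>A\<^esub> y = x \<otimes>\<^bsub>A\<^esub> hpart A (s + t) y \<oplus>\<^bsub>A\<^esub> x \<otimes>\<^bsub>A\<^esub> hpart A (s + t + 1) y"
    using assms x hpart_decomposition(2)[of y "s + t"] r_distr[of "hpart A (s + t) y" "hpart A (s + t + 1) y" x]
    by simp
  show "x \<otimes>\<^bsub>A\<^esub> hpart A (s + t) y \<in> hcomp A s"
    using hcomp_mult[OF assms(1) hpart_decomposition(1)[OF assms(2), of "s + t"]]
    by (cases s; cases t) simp_all
  show "x \<otimes>\<^bsub>A\<^esub> hpart A (s + t + 1) y \<in> hcomp A (s + 1)"
    using hcomp_mult[OF assms(1) hpart_decomposition(1)[OF assms(2), of "s + t + 1"]]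
    by (cases s; cases t) simp_all
qed

end

section \<open>Homogeneous ideals and their quotients\<close>

definition homogeneous :: "('k, 'a, 'm) superalgebra_scheme \<Rightarrow> 'a set \<Rightarrow> bool" where
  "homogeneous A I \<longleftrightarrow> (\<forall>x \<in> I. \<forall>s. hpart A s x \<in> I)"

context superalgebra
begin

text \<open>
  The elements all of whose homogeneous parts lie in the generated ideal form an ideal themselves,
  and it contains the generators. So it is the whole generated ideal.
\<close>

lemma homogeneous_genideal:
  assumes S: "S \<subseteq> (\<Union>s. hcomp A s)"
  shows "homogeneous A (Idl\<^bsub>A\<^esub> S)"
proof -
  have Sc: "S \<subseteq> carrier A" using S by blast
  let ?I = "Idl\<^bsub>A\<^esub> S"
  interpret I: ideal ?I A by (rule genideal_ideal[OF Sc])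
  let ?J = "{x \<in> carrier A. \<forall>s. hpart A s x \<in> ?I}"
  have "x \<otimes>\<^bsub>A\<^esub> a \<in> ?J \<and> a \<otimes>\<^bsub>A\<^esub> x \<in> ?J" if a: "a \<in> ?J" and x: "x \<in> carrier A" for a x
    using x
  proof (induction rule: homogeneous_induct)
    case (homogeneous s x)
    then show ?case
      using a hcomp_closed[OF homogeneous]
      by (simp add: hpart_mult_homogeneous_left hpart_mult_homogeneous_right
          I.I_l_closed I.I_r_closed)
  next
    case (add x y)
    then show ?case using a by (simp add: hpart_add l_distr r_distr)
  qed
  moreover have "subgroup ?J (add_monoid A)"
  proof (rule M.add.subgroupI)
    show "?J \<noteq> {}" by (auto intro!: exI[of _ "\<zero>\<^bsub>A\<^esub>"])
    show "x \<oplus>\<^bsub>A\<^esub> y \<in> ?J" if "x \<in> ?J" "y \<in> ?J" for x y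
      using that by (simp add: hpart_add)
    fix x assume x: "x \<in> ?J"
    have "hpart A s (\<ominus>\<^bsub>A\<^esub> x) = \<ominus>\<^bsub>A\<^esub> hpart A s x" for s
      using x hpart_add[of "\<ominus>\<^bsub>A\<^esub> x" x s] M.l_neg[of x]
        M.minus_equality[of "hpart A s (\<ominus>\<^bsub>A\<^esub> x)" "hpart A s x"]
      by auto
    then show "\<ominus>\<^bsub>A\<^esub> x \<in> ?J"
      using x by simp
  qed auto
  ultimately have "ideal ?J A"
    by (intro idealI ring_axioms) auto
  moreover have "S \<subseteq> ?J"
  proof
    fix x assume x: "x \<in> S"
    then obtain t where t: "x \<in> hcomp A t" using S by blast
    then show "x \<in> ?J"
      using x genideal_self[OF Sc] hcomp_closed[OF t] by (auto simp: hpart_homogeneous)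
  qed
  ultimately have "?I \<subseteq> ?J" by (rule genideal_minimal)
  then show ?thesis unfolding homogeneous_def by blast
qed

end

locale homogeneous_ideal = superalgebra R A + ideal I A
  for R :: "('k, 'r) ring_scheme" (structure) and A :: "('k, 'a) superalgebra" (structure) and I +
  assumes homogeneous: "homogeneous A I"
begin

abbreviation Q :: "('k, 'a set) superalgebra" where
  "Q \<equiv> quot_superalgebra A I"

abbreviation coset :: "'a \<Rightarrow> 'a set" where
  "coset x \<equiv> I +>\<^bsub>A\<^esub> x"

lemma quot_carrier: "carrier Q = coset ` carrier A"
  by (auto simp: quot_superalgebra_def FactRing_def A_RCOSETS_def')

lemma quot_hcomp: "hcomp Q s = coset ` hcomp A s"
  by (simp add: quot_superalgebra_def)

lemma quot_zero: "\<zero>\<^bsub>Q\<^esub> = coset \<zero>\<^bsub>A\<^esub>"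
  using a_rcos_zero[OF is_ideal zero_closed] by (simp add: quot_superalgebra_def FactRing_def)

lemma quot_one: "\<one>\<^bsub>Q\<^esub> = coset \<one>\<^bsub>A\<^esub>"
  by (simp add: quot_superalgebra_def FactRing_def)

lemma quot_add: "\<lbrakk>x \<in> carrier A; y \<in> carrier A\<rbrakk> \<Longrightarrow> coset x \<oplus>\<^bsub>Q\<^esub> coset y = coset (x \<oplus>\<^bsub>A\<^esub> y)"
  by (simp add: quot_superalgebra_def FactRing_def a_rcos_sum)

lemma quot_mult: "\<lbrakk>x \<in> carrier A; y \<in> carrier A\<rbrakk> \<Longrightarrow> coset x \<otimes>\<^bsub>Q\<^esub> coset y = coset (x \<otimes>\<^bsub>A\<^esub> y)"
  by (simp add: quot_superalgebra_def FactRing_def rcoset_mult_add)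

lemma coset_eq_iff:
  "\<lbrakk>x \<in> carrier A; y \<in> carrier A\<rbrakk> \<Longrightarrow> coset x = coset y \<longleftrightarrow> x \<ominus>\<^bsub>A\<^esub> y \<in> I"
  using quotient_eq_iff_same_a_r_cos[OF is_ideal] by blast

text \<open>Scalars act as multiplication by \<open>c \<odot> 1\<close>, so ring ideals are automatically submodules.\<close>

lemma smult_mem: "\<lbrakk>c \<in> carrier R; x \<in> I\<rbrakk> \<Longrightarrow> c \<odot>\<^bsub>A\<^esub> x \<in> I"
  using smult_mult_left[of c "\<one>\<^bsub>A\<^esub>" x] I_l_closed[of x "c \<odot>\<^bsub>A\<^esub> \<one>\<^bsub>A\<^esub>"] Icarr[of x] by simp

lemma quot_smult:
  assumes "c \<in> carrier R" "x \<in> carrier A"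
  shows "c \<odot>\<^bsub>Q\<^esub> coset x = coset (c \<odot>\<^bsub>A\<^esub> x)"
proof -
  have "coset (c \<odot>\<^bsub>A\<^esub> y) = coset (c \<odot>\<^bsub>A\<^esub> x)" if y: "y \<in> coset x" for y
  proof -
    from y obtain h where h: "h \<in> I" "y = h \<oplus>\<^bsub>A\<^esub> x"
      by (auto simp: a_r_coset_def')
    have hc: "h \<in> carrier A" by (rule Icarr[OF h(1)])
    have "c \<odot>\<^bsub>A\<^esub> y = c \<odot>\<^bsub>A\<^esub> h \<oplus>\<^bsub>A\<^esub> c \<odot>\<^bsub>A\<^esub> x"
      unfolding h(2) using assms hc by (rule_tac smult_r_distr)
    then have "coset (c \<odot>\<^bsub>A\<^esub> y) = coset (c \<odot>\<^bsub>A\<^esub> h) \<oplus>\<^bsub>Q\<^esub> coset (c \<odot>\<^bsub>A\<^esub> x)"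
      using assms hc by (simp add: quot_add)
    also have "coset (c \<odot>\<^bsub>A\<^esub> h) = coset \<zero>\<^bsub>A\<^esub>"
      using a_rcos_zero[OF is_ideal] smult_mem[OF assms(1) h(1)] by simp
    finally show ?thesis
      using assms by (simp add: quot_add)
  qed
  then have "(\<Union>y \<in> coset x. coset (c \<odot>\<^bsub>A\<^esub> y)) = (\<Union>y \<in> coset x. coset (c \<odot>\<^bsub>A\<^esub> x))"
    by (intro SUP_cong refl)
  then show ?thesis
    using a_rcos_self[OF assms(2)] by (auto simp: quot_superalgebra_def)
qed

text \<open>
  This is where homogeneity of the ideal enters: it makes homogeneous parts well defined on cosets,
  and so gives uniqueness of the decomposition in the quotient.
\<close>

lemma coset_hpart_cong:
  assumes "x \<in> carrier A" "y \<in> carrier A" "coset x = coset y"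
  shows "coset (hpart A s x) = coset (hpart A s y)"
proof -
  define z where "z = x \<ominus>\<^bsub>A\<^esub> y"
  then have z: "z \<in> I" "z \<in> carrier A" "x = z \<oplus>\<^bsub>A\<^esub> y"
    using assms coset_eq_iff by (auto simp: a_minus_def M.a_assoc M.l_neg)
  have "hpart A s x = hpart A s z \<oplus>\<^bsub>A\<^esub> hpart A s y"
    using z assms by (simp add: hpart_add)
  moreover have "coset (hpart A s z) = \<zero>\<^bsub>Q\<^esub>"
    using homogeneous z a_rcos_zero[OF is_ideal] a_rcos_zero[OF is_ideal zero_closed]
    unfolding homogeneous_def quot_zero by simp
  ultimately show ?thesis
    using z assms quot_add[of "hpart A s z" "hpart A s y"] quot_add[of "\<zero>\<^bsub>A\<^esub>" "hpart A s y"]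
    by (simp add: quot_zero)
qed

lemma quot_ring: "ring Q"
proof (rule ringI)
  show "abelian_group Q"
  proof (rule abelian_groupI)
    fix S assume "S \<in> carrier Q"
    then obtain x where x: "x \<in> carrier A" "S = coset x" by (auto simp: quot_carrier)
    then show "\<exists>S' \<in> carrier Q. S' \<oplus>\<^bsub>Q\<^esub> S = \<zero>\<^bsub>Q\<^esub>"
      by (intro bexI[of _ "coset (\<ominus>\<^bsub>A\<^esub> x)"])
        (auto simp: quot_carrier quot_add quot_zero M.l_neg)
  qed (auto simp: quot_carrier quot_add quot_zero M.a_ac)
  show "Group.monoid Q"
    by (rule monoidI) (auto simp: quot_carrier quot_one quot_mult m_assoc)
qed (auto simp: quot_carrier quot_add quot_mult l_distr r_distr)

lemma quot_module: "module R Q"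
proof (rule moduleI)
  show "abelian_group Q" by (rule ring.is_abelian_group[OF quot_ring])
qed (auto simp: quot_carrier quot_add quot_smult R.is_cring
    smult_l_distr smult_r_distr smult_assoc1)

lemma quot_is_superalgebra: "superalgebra R Q"
proof (intro superalgebra.intro superalgebra_axioms.intro quot_module quot_ring)
  interpret Q: Module.module R Q by (rule quot_module)
  show "submodule (hcomp Q s) R Q" for s
  proof (rule Q.submoduleI)
    show "\<ominus>\<^bsub>Q\<^esub> S \<in> hcomp Q s" if "S \<in> hcomp Q s" for S
    proof -
      from that obtain x where x: "x \<in> hcomp A s" "S = coset x" by (auto simp: quot_hcomp)
      then have n: "\<ominus>\<^bsub>A\<^esub> x \<in> hcomp A s" by (intro submoduleE(3)[OF hcomp_submodule])
      have "coset (\<ominus>\<^bsub>A\<^esub> x) \<oplus>\<^bsub>Q\<^esub> S = \<zero>\<^bsub>Q\<^esub>"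
        using x n hcomp_closed by (simp add: quot_add quot_zero M.l_neg)
      then have "\<ominus>\<^bsub>Q\<^esub> S = coset (\<ominus>\<^bsub>A\<^esub> x)"
        using x n hcomp_closed by (intro Q.minus_equality) (auto simp: quot_carrier)
      then show ?thesis using n by (simp add: quot_hcomp)
    qed
  qed (auto simp: quot_hcomp quot_carrier quot_zero quot_add quot_smult hcomp_closed
      hcomp_add hcomp_smult)
next
  fix S assume "S \<in> carrier Q"
  then obtain x where x: "x \<in> carrier A" "S = coset x" by (auto simp: quot_carrier)
  let ?P = "\<lambda>(Y, Z). Y \<in> hcomp Q 0 \<and> Z \<in> hcomp Q 1 \<and> S = Y \<oplus>\<^bsub>Q\<^esub> Z"
  show "\<exists>!p. ?P p"
  proof (rule ex1I)
    show "?P (coset (hpart A 0 x), coset (hpart A 1 x))"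
      using x hpart_decomposition[OF x(1), of 0] hpart_decomposition(1)[OF x(1), of 1]
      by (simp add: quot_hcomp quot_add)
  next
    fix p assume "?P p"
    then obtain y z where yz: "p = (coset y, coset z)" "y \<in> hcomp A 0" "z \<in> hcomp A 1"
      and "S = coset y \<oplus>\<^bsub>Q\<^esub> coset z"
      by (auto simp: quot_hcomp)
    then have "coset x = coset (y \<oplus>\<^bsub>A\<^esub> z)"
      using x hcomp_closed by (simp add: quot_add)
    from coset_hpart_cong[OF x(1) _ this]
    show "p = (coset (hpart A 0 x), coset (hpart A 1 x))"
      using yz hcomp_closed by (simp add: hpart_add hpart_homogeneous)
  qed
qed (auto simp: quot_hcomp quot_carrier quot_mult quot_smult hcomp_closed hcomp_mult
    smult_mult_left smult_mult_right)

lemma hpart_quot: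
  assumes x: "x \<in> carrier A"
  shows "hpart Q s (coset x) = coset (hpart A s x)"
proof -
  interpret Q: superalgebra R Q by (rule quot_is_superalgebra)
  show ?thesis
  proof (rule Q.hpartI)
    show "coset x = coset (hpart A s x) \<oplus>\<^bsub>Q\<^esub> coset (hpart A (s + 1) x)"
      using x hpart_decomposition(2)[OF x, of s] by (simp add: quot_add)
  qed (use x hpart_decomposition(1)[OF x] in \<open>auto simp: quot_hcomp\<close>)
qed

end

section \<open>Twists by cocycles\<close>

text \<open>
  Normalized 2-cocycles are what makes the twisted product unital and associative. That the values
  are units makes the passage to the twist reversible.
\<close>

locale superalgebra_twist = superalgebra R A
  for R :: "('k, 'r) ring_scheme" (structure) and A :: "('k, 'a) superalgebra" (structure) +
  fixes \<zeta> :: "bit \<Rightarrow> bit \<Rightarrow> 'k"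
  assumes unit: "\<zeta> s t \<in> Units R"
    and normalized: "\<zeta> 0 s = \<one>" "\<zeta> s 0 = \<one>"
    and cocycle: "\<zeta> s t \<otimes> \<zeta> (s + t) u = \<zeta> t u \<otimes> \<zeta> s (t + u)"
begin

abbreviation T :: "('k, 'a) superalgebra" where
  "T \<equiv> twist \<zeta> A"

lemma twist_simps [simp]:
  "carrier T = carrier A" "\<one>\<^bsub>T\<^esub> = \<one>\<^bsub>A\<^esub>" "\<zero>\<^bsub>T\<^esub> = \<zero>\<^bsub>A\<^esub>" "add T = add A"
  "module.smult T = module.smult A" "hcomp T = hcomp A"
  by (simp_all add: twist_def)

lemma hpart_twist [simp]: "hpart T = hpart A"
  by (simp add: hpart_def fun_eq_iff)

lemma coeff_closed [simp]: "\<zeta> s t \<in> carrier R"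
  using unit by blast

lemma twist_mult:
  assumes "x \<in> carrier A" "y \<in> carrier A"
  shows "x \<otimes>\<^bsub>T\<^esub> y =
    (\<zeta> 0 0 \<odot>\<^bsub>A\<^esub> (hpart A 0 x \<otimes>\<^bsub>A\<^esub> hpart A 0 y) \<oplus>\<^bsub>A\<^esub> \<zeta> 0 1 \<odot>\<^bsub>A\<^esub> (hpart A 0 x \<otimes>\<^bsub>A\<^esub> hpart A 1 y))
    \<oplus>\<^bsub>A\<^esub> (\<zeta> 1 0 \<odot>\<^bsub>A\<^esub> (hpart A 1 x \<otimes>\<^bsub>A\<^esub> hpart A 0 y) \<oplus>\<^bsub>A\<^esub> \<zeta> 1 1 \<odot>\<^bsub>A\<^esub> (hpart A 1 x \<otimes>\<^bsub>A\<^esub> hpart A 1 y))"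
  using assms by (simp add: twist_def M.a_ac)

lemma twist_mult_homogeneous:
  assumes "x \<in> hcomp A s" "y \<in> hcomp A t"
  shows "x \<otimes>\<^bsub>T\<^esub> y = \<zeta> s t \<odot>\<^bsub>A\<^esub> (x \<otimes>\<^bsub>A\<^esub> y)"
  using assms hcomp_closed[OF assms(1)] hcomp_closed[OF assms(2)]
  by (cases s; cases t; simp add: twist_mult hpart_homogeneous)

lemma twist_mult_closed [simp]: "\<lbrakk>x \<in> carrier A; y \<in> carrier A\<rbrakk> \<Longrightarrow> x \<otimes>\<^bsub>T\<^esub> y \<in> carrier A"
  by (simp add: twist_mult)

lemma twist_l_distr:
  "\<lbrakk>x \<in> carrier A; y \<in> carrier A; z \<in> carrier A\<rbrakk>
    \<Longrightarrow> (x \<oplus>\<^bsub>A\<^esub> y) \<otimes>\<^bsub>T\<^esub> z = x \<otimes>\<^bsub>T\<^esub> z \<oplus>\<^bsub>A\<^esub> y \<otimes>\<^bsub>T\<^esub> z"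
  by (simp add: twist_mult hpart_add l_distr smult_r_distr M.a_ac)

lemma twist_r_distr:
  "\<lbrakk>x \<in> carrier A; y \<in> carrier A; z \<in> carrier A\<rbrakk>
    \<Longrightarrow> z \<otimes>\<^bsub>T\<^esub> (x \<oplus>\<^bsub>A\<^esub> y) = z \<otimes>\<^bsub>T\<^esub> x \<oplus>\<^bsub>A\<^esub> z \<otimes>\<^bsub>T\<^esub> y"
  by (simp add: twist_mult hpart_add r_distr smult_r_distr M.a_ac)

lemma twist_assoc_homogeneous:
  assumes x: "x \<in> hcomp A s" and y: "y \<in> hcomp A t" and z: "z \<in> hcomp A u"
  shows "(x \<otimes>\<^bsub>T\<^esub> y) \<otimes>\<^bsub>T\<^esub> z = x \<otimes>\<^bsub>T\<^esub> (y \<otimes>\<^bsub>T\<^esub> z)"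
proof -
  note c = hcomp_closed[OF x] hcomp_closed[OF y] hcomp_closed[OF z]
  have "(x \<otimes>\<^bsub>T\<^esub> y) \<otimes>\<^bsub>T\<^esub> z = \<zeta> (s + t) u \<odot>\<^bsub>A\<^esub> ((\<zeta> s t \<odot>\<^bsub>A\<^esub> (x \<otimes>\<^bsub>A\<^esub> y)) \<otimes>\<^bsub>A\<^esub> z)"
    using twist_mult_homogeneous[OF hcomp_smult[OF coeff_closed hcomp_mult[OF x y]] z]
    by (simp add: twist_mult_homogeneous[OF x y])
  also have "\<dots> = (\<zeta> s t \<otimes> \<zeta> (s + t) u) \<odot>\<^bsub>A\<^esub> (x \<otimes>\<^bsub>A\<^esub> y \<otimes>\<^bsub>A\<^esub> z)"
    using c R.m_comm[of "\<zeta> s t" "\<zeta> (s + t) u"]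
    by (simp add: smult_mult_left flip: smult_assoc1)
  also have "\<dots> = \<zeta> s (t + u) \<odot>\<^bsub>A\<^esub> (x \<otimes>\<^bsub>A\<^esub> (\<zeta> t u \<odot>\<^bsub>A\<^esub> (y \<otimes>\<^bsub>A\<^esub> z)))"
    using c R.m_comm[of "\<zeta> t u" "\<zeta> s (t + u)"]
    by (simp add: smult_mult_right smult_assoc1 cocycle m_assoc)
  also have "\<dots> = x \<otimes>\<^bsub>T\<^esub> (y \<otimes>\<^bsub>T\<^esub> z)"
    using twist_mult_homogeneous[OF x hcomp_smult[OF coeff_closed hcomp_mult[OF y z]]]
    by (simp add: twist_mult_homogeneous[OF y z])
  finally show ?thesis .
qed

lemma twist_assoc:
  assumes "x \<in> carrier A" "y \<in> carrier A" "z \<in> carrier A"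
  shows "(x \<otimes>\<^bsub>T\<^esub> y) \<otimes>\<^bsub>T\<^esub> z = x \<otimes>\<^bsub>T\<^esub> (y \<otimes>\<^bsub>T\<^esub> z)"
  using assms(1)
proof (induction rule: homogeneous_induct)
  case (homogeneous s x)
  note x = homogeneous hcomp_closed[OF homogeneous]
  from assms(2) show ?case
  proof (induction rule: homogeneous_induct)
    case (homogeneous t y)
    note y = homogeneous hcomp_closed[OF homogeneous]
    from assms(3) show ?case
    proof (induction rule: homogeneous_induct)
      case (homogeneous u z)
      then show ?case by (rule twist_assoc_homogeneous[OF x(1) y(1)])
    next
      case (add z z')
      then show ?case using x(2) y(2) by (simp add: twist_r_distr)
    qed
  next
    case (add y y')
    then show ?case using x(2) assms(3) by (simp add: twist_l_distr twist_r_distr)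
  qed
next
  case (add x x')
  then show ?case using assms(2,3) by (simp add: twist_l_distr)
qed

lemma twist_one:
  assumes "x \<in> carrier A"
  shows "\<one>\<^bsub>A\<^esub> \<otimes>\<^bsub>T\<^esub> x = x" "x \<otimes>\<^bsub>T\<^esub> \<one>\<^bsub>A\<^esub> = x"
  using assms hpart_decomposition(2)[OF assms, of 0]
  by (simp_all add: twist_mult hpart_homogeneous[OF one_even] normalized)

lemma twist_smult_left:
  assumes "c \<in> carrier R" "x \<in> carrier A" "y \<in> carrier A"
  shows "(c \<odot>\<^bsub>A\<^esub> x) \<otimes>\<^bsub>T\<^esub> y = c \<odot>\<^bsub>A\<^esub> (x \<otimes>\<^bsub>T\<^esub> y)"
proof -
  have "\<zeta> s t \<odot>\<^bsub>A\<^esub> (c \<odot>\<^bsub>A\<^esub> z) = c \<odot>\<^bsub>A\<^esub> (\<zeta> s t \<odot>\<^bsub>A\<^esub> z)" if "z \<in> carrier A" for s t z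
    using assms(1) that by (simp add: R.m_comm flip: smult_assoc1)
  then show ?thesis
    using assms by (simp add: twist_mult hpart_smult smult_mult_left smult_r_distr)
qed

lemma twist_smult_right:
  assumes "c \<in> carrier R" "x \<in> carrier A" "y \<in> carrier A"
  shows "x \<otimes>\<^bsub>T\<^esub> (c \<odot>\<^bsub>A\<^esub> y) = c \<odot>\<^bsub>A\<^esub> (x \<otimes>\<^bsub>T\<^esub> y)"
proof -
  have "\<zeta> s t \<odot>\<^bsub>A\<^esub> (c \<odot>\<^bsub>A\<^esub> z) = c \<odot>\<^bsub>A\<^esub> (\<zeta> s t \<odot>\<^bsub>A\<^esub> z)" if "z \<in> carrier A" for s t z
    using assms(1) that by (simp add: R.m_comm flip: smult_assoc1)
  then show ?thesis
    using assms by (simp add: twist_mult hpart_smult smult_mult_right smult_r_distr)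
qed

lemma twist_abelian_group: "abelian_group T"
  by (rule abelian_groupI) (auto simp: M.a_ac intro: bexI[of _ "\<ominus>\<^bsub>A\<^esub> _"] M.l_neg)

lemma twist_ring: "ring T"
  by (rule ringI[OF twist_abelian_group])
    (auto intro!: monoidI simp: twist_assoc twist_one twist_l_distr twist_r_distr)

lemma twist_is_superalgebra: "superalgebra R T"
proof (intro superalgebra.intro superalgebra_axioms.intro twist_ring)
  show "module R T"
    by (rule moduleI)
      (auto simp: twist_abelian_group R.is_cring smult_l_distr smult_r_distr smult_assoc1)
  show "submodule (hcomp T s) R T" for s
    using hcomp_submodule[of s]
    by (simp add: submodule_def subgroup_def submodule_axioms_def)
qed (auto simp: twist_smult_left twist_smult_right hcomp_direct_sum twist_mult_homogeneous
    hcomp_mult hcomp_smult)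

section \<open>Ideals and quotients of twists\<close>

lemma twist_homogeneous_iff: "homogeneous T I \<longleftrightarrow> homogeneous A I"
  by (simp add: homogeneous_def)

text \<open>
  A twisted product is a combination of products of homogeneous parts, and a homogeneous ideal
  contains the homogeneous parts of its elements.
\<close>

lemma twist_ideal:
  assumes I: "ideal I A" and hom: "homogeneous A I"
  shows "ideal I T"
proof (intro idealI twist_ring)
  interpret I: homogeneous_ideal R A I
    by (intro homogeneous_ideal.intro homogeneous_ideal_axioms.intro
        superalgebra_axioms I hom)
  show "subgroup I (add_monoid T)"
    using I.a_subgroup by (simp add: subgroup_def)
  have h: "hpart A s a \<in> I" if "a \<in> I" for a s
    using hom that unfolding homogeneous_def by blast
  fix a x assume a: "a \<in> I" and x: "x \<in> carrier T"
  have ac: "a \<in> carrier A" by (rule I.Icarr[OF a])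
  show "x \<otimes>\<^bsub>T\<^esub> a \<in> I" "a \<otimes>\<^bsub>T\<^esub> x \<in> I"
    using ac x h[OF a]
    by (simp_all add: twist_mult I.smult_mem I.I_l_closed I.I_r_closed I.a_closed)
qed

text \<open>
  Conversely, the original product of homogeneous elements is a multiple of the twisted one by the
  inverse of a value of \<open>\<zeta>\<close>.
\<close>

lemma untwist_ideal:
  assumes I: "ideal I T" and hom: "homogeneous A I"
  shows "ideal I A"
proof (intro idealI ring_axioms)
  interpret T: superalgebra R T by (rule twist_is_superalgebra)
  interpret I: homogeneous_ideal R T I
    by (intro homogeneous_ideal.intro homogeneous_ideal_axioms.intro T.superalgebra_axioms I)
      (simp add: twist_homogeneous_iff hom)
  show "subgroup I (add_monoid A)"
    using I.a_subgroup by (simp add: subgroup_def)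
  have untwist: "x \<otimes>\<^bsub>A\<^esub> y = inv \<zeta> s t \<odot>\<^bsub>A\<^esub> (x \<otimes>\<^bsub>T\<^esub> y)"
    if "x \<in> hcomp A s" "y \<in> hcomp A t" for x y s t
    using that hcomp_closed[OF that(1)] hcomp_closed[OF that(2)] unit[of s t]
    by (simp add: twist_mult_homogeneous flip: smult_assoc1)
  have *: "x \<otimes>\<^bsub>A\<^esub> a \<in> I \<and> a \<otimes>\<^bsub>A\<^esub> x \<in> I"
    if a: "a \<in> I" "a \<in> hcomp A t" and x: "x \<in> carrier A" for a x t
    using x
  proof (induction rule: homogeneous_induct)
    case (homogeneous s x)
    then show ?case
      using a I.I_l_closed[OF a(1), of x] I.I_r_closed[OF a(1), of x] hcomp_closed[OF homogeneous]
        I.smult_mem[of "inv \<zeta> s t" "x \<otimes>\<^bsub>T\<^esub> a"] I.smult_mem[of "inv \<zeta> t s" "a \<otimes>\<^bsub>T\<^esub> x"]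
        unit[of s t] unit[of t s]
      by (simp add: untwist[OF _ a(2)] untwist[OF a(2)])
  next
    case (add x y)
    then show ?case
      using I.a_closed I.Icarr[OF a(1)] by (simp add: l_distr r_distr)
  qed
  fix a x assume a: "a \<in> I" and x: "x \<in> carrier A"
  have ac: "a \<in> carrier A" using I.Icarr[OF a] by simp
  have h: "hpart A s a \<in> I" for s
    using hom a unfolding homogeneous_def by blast
  note dec = hpart_decomposition[OF ac]
  have "x \<otimes>\<^bsub>A\<^esub> a = x \<otimes>\<^bsub>A\<^esub> hpart A 0 a \<oplus>\<^bsub>A\<^esub> x \<otimes>\<^bsub>A\<^esub> hpart A 1 a"
    "a \<otimes>\<^bsub>A\<^esub> x = hpart A 0 a \<otimes>\<^bsub>A\<^esub> x \<oplus>\<^bsub>A\<^esub> hpart A 1 a \<otimes>\<^bsub>A\<^esub> x"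
    using ac x dec(2)[of 0] r_distr[of "hpart A 0 a" "hpart A 1 a" x]
      l_distr[of "hpart A 0 a" "hpart A 1 a" x] by simp_all
  then show "x \<otimes>\<^bsub>A\<^esub> a \<in> I" "a \<otimes>\<^bsub>A\<^esub> x \<in> I"
    using *[OF h dec(1) x] I.a_closed by simp_all
qed

lemma twist_genideal:
  assumes S: "S \<subseteq> (\<Union>s. hcomp A s)"
  shows "Idl\<^bsub>T\<^esub> S = Idl\<^bsub>A\<^esub> S"
proof
  interpret T: superalgebra R T by (rule twist_is_superalgebra)
  have Sc: "S \<subseteq> carrier A" using S hcomp_closed by blast
  then have Sc': "S \<subseteq> carrier T" by simp
  show "Idl\<^bsub>T\<^esub> S \<subseteq> Idl\<^bsub>A\<^esub> S"
    by (intro T.genideal_minimal twist_ideal genideal_ideal Sc genideal_self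
        homogeneous_genideal S)
  have "homogeneous A (Idl\<^bsub>T\<^esub> S)"
    using T.homogeneous_genideal[of S] S by (simp add: twist_homogeneous_iff)
  then show "Idl\<^bsub>A\<^esub> S \<subseteq> Idl\<^bsub>T\<^esub> S"
    by (intro genideal_minimal untwist_ideal T.genideal_ideal Sc' T.genideal_self)
qed

text \<open>Homogeneous parts of a coset are computed on representatives, hence so is the twisted product.\<close>

lemma coset_twist_mult:
  assumes "homogeneous_ideal R A I" and x: "x \<in> carrier A" and y: "y \<in> carrier A"
  shows "(I +>\<^bsub>A\<^esub> x) \<otimes>\<^bsub>twist \<zeta> (quot_superalgebra A I)\<^esub> (I +>\<^bsub>A\<^esub> y) = I +>\<^bsub>A\<^esub> (x \<otimes>\<^bsub>T\<^esub> y)"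
proof -
  interpret I: homogeneous_ideal R A I by fact
  interpret Q: superalgebra_twist R I.Q \<zeta>
    by (intro superalgebra_twist.intro superalgebra_twist_axioms.intro I.quot_is_superalgebra
        unit normalized cocycle)
  have "I.coset x \<in> carrier I.Q" "I.coset y \<in> carrier I.Q"
    using x y by (auto simp: I.quot_carrier)
  then show ?thesis
    using x y
    by (simp add: Q.twist_mult twist_mult I.hpart_quot I.quot_mult I.quot_smult I.quot_add)
qed

end

lemma (in ring_hom_ring) image_genideal_subset:
  assumes S: "M \<subseteq> carrier R"
  shows "h ` (Idl\<^bsub>R\<^esub> M) \<subseteq> Idl\<^bsub>S\<^esub> (h ` M)"
proof -
  have hM: "h ` M \<subseteq> carrier S" using S by auto
  have "M \<subseteq> {r \<in> carrier R. h r \<in> Idl\<^bsub>S\<^esub> (h ` M)}"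
    using S S.genideal_self[OF hM] by auto
  then have "Idl\<^bsub>R\<^esub> M \<subseteq> {r \<in> carrier R. h r \<in> Idl\<^bsub>S\<^esub> (h ` M)}"
    by (intro R.genideal_minimal ideal_vimage S.genideal_ideal hM)
  then show ?thesis by blast
qed

lemma ring_iso_image_genideal:
  assumes "ring A" "ring B" and h: "h \<in> ring_iso A B" and S: "S \<subseteq> carrier A"
  shows "h ` (Idl\<^bsub>A\<^esub> S) = Idl\<^bsub>B\<^esub> (h ` S)"
proof
  show "h ` (Idl\<^bsub>A\<^esub> S) \<subseteq> Idl\<^bsub>B\<^esub> (h ` S)"
    using assms by (intro ring_hom_ring.image_genideal_subset ring_hom_ringI2)
      (simp_all add: ring_iso_def)
  let ?g = "inv_into (carrier A) h"
  have "?g \<in> ring_iso B A" by (rule ring_iso_set_sym[OF assms(1) h])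
  then have hom: "ring_hom_ring B A ?g"
    using assms(1,2) by (intro ring_hom_ringI2) (simp_all add: ring_iso_def)
  have bij: "bij_betw h (carrier A) (carrier B)" using h by (simp add: ring_iso_def)
  have hS: "h ` S \<subseteq> carrier B" using bij S by (auto simp: bij_betw_def)
  have "?g ` h ` S = S"
    using bij S by (simp add: bij_betw_def inv_into_image_cancel)
  then have g: "?g ` (Idl\<^bsub>B\<^esub> (h ` S)) \<subseteq> Idl\<^bsub>A\<^esub> S"
    using ring_hom_ring.image_genideal_subset[OF hom hS] by simp
  show "Idl\<^bsub>B\<^esub> (h ` S) \<subseteq> h ` (Idl\<^bsub>A\<^esub> S)"
  proof
    fix y assume y: "y \<in> Idl\<^bsub>B\<^esub> (h ` S)"
    then have "y \<in> carrier B"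
      using ideal.Icarr[OF ring.genideal_ideal[OF assms(2) hS]] by blast
    then have "y = h (?g y)" using bij by (simp add: bij_betw_inv_into_right)
    then show "y \<in> h ` (Idl\<^bsub>A\<^esub> S)" using g y by blast
  qed
qed

text \<open>
  The induced map on quotients is the direct image of cosets, which is well defined without any
  choice of representatives. The image of the ideal generated by \<open>S\<close> is first an ideal of the twist,
  generated by \<open>f ` S\<close>, and hence equal to the ideal of \<open>A\<close> with the same generators.
\<close>

lemma quotient_twist_iso:
  fixes R :: "'k ring" and A :: "('k, 'a) superalgebra" and B :: "('k, 'b) superalgebra"
  assumes A: "superalgebra_twist R A \<zeta>"
    and f: "f \<in> superalgebra_iso R B (twist \<zeta> A)"
    and S: "S \<subseteq> (\<Union>s. hcomp B s)"
  defines "I \<equiv> Idl\<^bsub>B\<^esub> S" and "J \<equiv> Idl\<^bsub>A\<^esub> (f ` S)"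
  shows "(`) f \<in> superalgebra_iso R (quot_superalgebra B I) (twist \<zeta> (quot_superalgebra A J))"
    and "\<And>x. x \<in> carrier B \<Longrightarrow> f ` (I +>\<^bsub>B\<^esub> x) = J +>\<^bsub>A\<^esub> f x"
proof -
  interpret A: superalgebra_twist R A \<zeta> by fact
  interpret T: superalgebra R A.T by (rule A.twist_is_superalgebra)
  interpret B: superalgebra R B using f by (simp add: superalgebra_iso_def)
  have hom: "f \<in> ring_hom B A.T" and bij: "bij_betw f (carrier B) (carrier A)"
    and smult: "\<And>c x. \<lbrakk>c \<in> carrier R; x \<in> carrier B\<rbrakk> \<Longrightarrow> f (c \<odot>\<^bsub>B\<^esub> x) = c \<odot>\<^bsub>A\<^esub> f x"
    and "\<forall>s. f ` hcomp B s \<subseteq> hcomp A s"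
    using f by (simp_all add: superalgebra_iso_def)
  then have graded: "\<And>s x. x \<in> hcomp B s \<Longrightarrow> f x \<in> hcomp A s" by blast
  note hom_simps = ring_hom_memE(2-)[OF hom, simplified]
  have fc [simp]: "f x \<in> carrier A" if "x \<in> carrier B" for x
    using bij that by (auto simp: bij_betw_def)
  have Sc: "S \<subseteq> carrier B" using S B.hcomp_closed by blast
  have fS: "f ` S \<subseteq> (\<Union>s. hcomp A s)" using S graded by blast
  have fSc: "f ` S \<subseteq> carrier A" using Sc by auto
  interpret I: homogeneous_ideal R B I
    unfolding I_def
    by (intro homogeneous_ideal.intro homogeneous_ideal_axioms.intro B.superalgebra_axioms
        B.genideal_ideal Sc B.homogeneous_genideal S)
  interpret J: homogeneous_ideal R A J
    unfolding J_def
    by (intro homogeneous_ideal.intro homogeneous_ideal_axioms.intro A.superalgebra_axioms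
        A.genideal_ideal fSc A.homogeneous_genideal fS)
  interpret Q: superalgebra_twist R J.Q \<zeta>
    by (intro superalgebra_twist.intro superalgebra_twist_axioms.intro J.quot_is_superalgebra
        A.unit A.normalized A.cocycle)
  have image: "f ` I = J"
    using ring_iso_image_genideal[OF B.ring_axioms T.ring_axioms _ Sc] hom bij A.twist_genideal[OF fS]
    by (simp add: I_def J_def ring_iso_def)
  show coset: "f ` I.coset x = J.coset (f x)" if "x \<in> carrier B" for x
  proof -
    have "f ` I.coset x = (\<lambda>h. f h \<oplus>\<^bsub>A\<^esub> f x) ` I"
      using that I.Icarr hom_simps by (force simp: a_r_coset_def' image_iff)
    then show ?thesis
      by (auto simp: a_r_coset_def' simp flip: image)
  qed
  have inj: "inj_on ((`) f) (carrier I.Q)"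
  proof (rule inj_on_image)
    have "\<Union> (carrier I.Q) \<subseteq> carrier B"
      using B.a_r_coset_subset_G[OF I.a_subset] by (auto simp: I.quot_carrier)
    then show "inj_on f (\<Union> (carrier I.Q))"
      using bij inj_on_subset by (auto simp: bij_betw_def)
  qed
  have "(`) f ` carrier I.Q = carrier J.Q"
  proof -
    have "(`) f ` carrier I.Q = J.coset ` f ` carrier B"
      by (force simp: I.quot_carrier image_image coset)
    then show ?thesis using bij by (simp add: J.quot_carrier bij_betw_def)
  qed
  with inj have bijQ: "bij_betw ((`) f) (carrier I.Q) (carrier J.Q)"
    by (simp add: bij_betw_def)
  have homQ: "(`) f \<in> ring_hom I.Q Q.T"
  proof (rule ring_hom_memI)
    fix M N assume "M \<in> carrier I.Q" "N \<in> carrier I.Q"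
    then obtain x y where xy: "x \<in> carrier B" "y \<in> carrier B" "M = I.coset x" "N = I.coset y"
      by (auto simp: I.quot_carrier)
    show "f ` M \<in> carrier Q.T"
      using xy by (simp add: coset J.quot_carrier)
    have "f ` (M \<otimes>\<^bsub>I.Q\<^esub> N) = J.coset (f x \<otimes>\<^bsub>A.T\<^esub> f y)"
      using xy coset[of "x \<otimes>\<^bsub>B\<^esub> y"] by (simp add: I.quot_mult hom_simps)
    then show "f ` (M \<otimes>\<^bsub>I.Q\<^esub> N) = f ` M \<otimes>\<^bsub>Q.T\<^esub> f ` N"
      using xy by (simp add: coset A.coset_twist_mult[OF J.homogeneous_ideal_axioms])
    have "f ` (M \<oplus>\<^bsub>I.Q\<^esub> N) = J.coset (f x \<oplus>\<^bsub>A\<^esub> f y)"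
      using xy coset[of "x \<oplus>\<^bsub>B\<^esub> y"] by (simp add: I.quot_add hom_simps)
    then show "f ` (M \<oplus>\<^bsub>I.Q\<^esub> N) = f ` M \<oplus>\<^bsub>Q.T\<^esub> f ` N"
      using xy by (simp add: coset J.quot_add)
  next
    show "f ` \<one>\<^bsub>I.Q\<^esub> = \<one>\<^bsub>Q.T\<^esub>"
      using coset[OF B.one_closed] by (simp add: I.quot_one J.quot_one hom_simps)
  qed
  show "(`) f \<in> superalgebra_iso R I.Q Q.T"
    unfolding superalgebra_iso_def
    using I.quot_is_superalgebra Q.twist_is_superalgebra homQ bijQ
    by (auto simp: I.quot_carrier I.quot_hcomp J.quot_hcomp I.quot_smult J.quot_smult coset smult
        B.hcomp_closed graded)
qed

section \<open>The free superalgebra\<close>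

lemma sign_of_add: "sign_of (x + y) = (sign_of x * sign_of y :: 'a::ring_1)"
  by (cases x; cases y) (simp_all add: sign_of_def)

lemma of_int_sign_of: "of_int (sign_of x) = (sign_of x :: 'a::ring_1)"
  by (simp add: sign_of_def)

lemma nc_const_mult: "nc_const (a * b) = nc_const a * nc_const b"
  by (simp add: nc_const_def mult_single)

lemma nc_const_add: "nc_const (a + b) = nc_const a + nc_const b"
  by (simp add: nc_const_def single_add)

lemma nc_const_one [simp]: "nc_const 1 = 1"
  by (simp add: nc_const_def)

lemma nc_const_sign_of: "nc_const (sign_of x) = sign_of x"
  by (simp add: nc_const_def sign_of_def single_uminus)

lemma ncpoly_sum_monomials:
  fixes f :: "'x ncpoly"
  shows "f = (\<Sum>w \<in> Poly_Mapping.keys f. Poly_Mapping.single w (Poly_Mapping.lookup f w))"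
  by (rule poly_mapping_eqI)
    (simp add: lookup_sum lookup_single when_def in_keys_iff)

lemma ncpoly_mult_sum_monomials:
  fixes f g :: "'x ncpoly"
  shows "f * g = (\<Sum>v \<in> Poly_Mapping.keys f. \<Sum>w \<in> Poly_Mapping.keys g.
    Poly_Mapping.single (v + w) (Poly_Mapping.lookup f v * Poly_Mapping.lookup g w))"
  by (subst ncpoly_sum_monomials[of f], subst ncpoly_sum_monomials[of g])
    (simp add: sum_product mult_single)

lemma lookup_nc_const_mult:
  "Poly_Mapping.lookup (nc_const c * f) w = c * Poly_Mapping.lookup f w"
  "Poly_Mapping.lookup (f * nc_const c) w = c * Poly_Mapping.lookup f w"
proof -
  have "nc_const c * f = (\<Sum>v \<in> Poly_Mapping.keys f. Poly_Mapping.single v (c * Poly_Mapping.lookup f v))"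
    by (subst ncpoly_sum_monomials[of f]) (simp add: sum_distrib_left nc_const_def mult_single)
  then show "Poly_Mapping.lookup (nc_const c * f) w = c * Poly_Mapping.lookup f w"
    by (simp add: lookup_sum lookup_single when_def in_keys_iff)
  have "f * nc_const c = (\<Sum>v \<in> Poly_Mapping.keys f. Poly_Mapping.single v (c * Poly_Mapping.lookup f v))"
    by (subst ncpoly_sum_monomials[of f])
      (simp add: sum_distrib_right nc_const_def mult_single mult.commute)
  then show "Poly_Mapping.lookup (f * nc_const c) w = c * Poly_Mapping.lookup f w"
    by (simp add: lookup_sum lookup_single when_def in_keys_iff)
qed

lemma nc_const_commute: "f * nc_const c = nc_const c * f"
  by (rule poly_mapping_eqI) (simp add: lookup_nc_const_mult)

lemma keys_nc_const_mult: "Poly_Mapping.keys (nc_const c * f) \<subseteq> Poly_Mapping.keys f"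
  by (auto simp: in_keys_iff lookup_nc_const_mult)

lemma letters_simps [simp]:
  "letters (v + w) = letters v @ letters w" "letters 0 = []"
  by (simp_all add: plus_free_monoid_def zero_free_monoid_def)

lemma word_deg_simps [simp]:
  "word_deg d (v + w) = word_deg d v + word_deg d w" "word_deg d 0 = 0"
  by (simp_all add: word_deg_def)

lemma lookup_nc_part:
  "Poly_Mapping.lookup (nc_part d s f) w = (if word_deg d w = s then Poly_Mapping.lookup f w else 0)"
  by (simp add: nc_part_def lookup_sum lookup_single when_def in_keys_iff)

lemma nc_part_homogeneous:
  assumes "\<And>w. w \<in> Poly_Mapping.keys f \<Longrightarrow> word_deg d w = t"
  shows "nc_part d s f = (if s = t then f else 0)"
  using assms by (intro poly_mapping_eqI) (auto simp: lookup_nc_part in_keys_iff)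

lemma free_hcomp_iff:
  "f \<in> hcomp (free_superalgebra B d) s \<longleftrightarrow>
    (\<forall>w \<in> Poly_Mapping.keys f. set (letters w) \<subseteq> B \<and> word_deg d w = s)"
  by (simp add: free_superalgebra_def)

lemma free_carrier_iff:
  "f \<in> carrier (free_superalgebra B d) \<longleftrightarrow> (\<forall>w \<in> Poly_Mapping.keys f. set (letters w) \<subseteq> B)"
  by (simp add: free_superalgebra_def)

lemma free_simps [simp]:
  "f \<otimes>\<^bsub>free_superalgebra B d\<^esub> g = f * g" "f \<oplus>\<^bsub>free_superalgebra B d\<^esub> g = f + g"
  "\<one>\<^bsub>free_superalgebra B d\<^esub> = 1" "\<zero>\<^bsub>free_superalgebra B d\<^esub> = 0"
  "c \<odot>\<^bsub>free_superalgebra B d\<^esub> f = nc_const c * f"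
  by (simp_all add: free_superalgebra_def)

lemma Cq_ring_simps [simp]:
  "carrier Cq_ring = UNIV" "a \<otimes>\<^bsub>Cq_ring\<^esub> b = a * b" "a \<oplus>\<^bsub>Cq_ring\<^esub> b = a + b" "\<one>\<^bsub>Cq_ring\<^esub> = 1"
  by (simp_all add: ring_of_type_algebra_def)

lemma free_hcomp_add:
  "\<lbrakk>f \<in> hcomp (free_superalgebra B d) s; g \<in> hcomp (free_superalgebra B d) s\<rbrakk>
    \<Longrightarrow> f + g \<in> hcomp (free_superalgebra B d) s"
  unfolding free_hcomp_iff using keys_add[of f g] by blast

lemma free_hcomp_mult:
  assumes "f \<in> hcomp (free_superalgebra B d) s" "g \<in> hcomp (free_superalgebra B d) t"
  shows "f * g \<in> hcomp (free_superalgebra B d) (s + t)"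
  using assms keys_mult[of f g] unfolding free_hcomp_iff by fastforce

lemma free_hcomp_smult:
  "f \<in> hcomp (free_superalgebra B d) s \<Longrightarrow> nc_const c * f \<in> hcomp (free_superalgebra B d) s"
  unfolding free_hcomp_iff using keys_nc_const_mult by blast

lemma nc_const_hcomp: "nc_const c \<in> hcomp (free_superalgebra B d) 0"
  by (simp add: free_hcomp_iff nc_const_def)

lemma free_hcomp_sign:
  assumes "f \<in> hcomp (free_superalgebra B d) s"
  shows "sign_of t * f \<in> hcomp (free_superalgebra B d) s"
  using free_hcomp_smult[OF assms, of "sign_of t"] by (simp add: nc_const_sign_of)

lemma free_hcomp_zero [simp]: "0 \<in> hcomp (free_superalgebra B d) s"
  by (simp add: free_hcomp_iff)

lemma free_hcomp_sum:
  "(\<And>x. x \<in> I \<Longrightarrow> f x \<in> hcomp (free_superalgebra B d) s)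
    \<Longrightarrow> (\<Sum>x \<in> I. f x) \<in> hcomp (free_superalgebra B d) s"
  by (induction I rule: infinite_finite_induct) (auto intro: free_hcomp_add)

lemma free_hcomp_diff:
  "\<lbrakk>f \<in> hcomp (free_superalgebra B d) s; g \<in> hcomp (free_superalgebra B d) s\<rbrakk>
    \<Longrightarrow> f - g \<in> hcomp (free_superalgebra B d) s"
  unfolding free_hcomp_iff using keys_diff[of f g] by blast

lemma free_carrier_add:
  "\<lbrakk>f \<in> carrier (free_superalgebra B d); g \<in> carrier (free_superalgebra B d)\<rbrakk>
    \<Longrightarrow> f + g \<in> carrier (free_superalgebra B d)"
  unfolding free_carrier_iff using keys_add[of f g] by blast

lemma free_carrier_mult:
  assumes "f \<in> carrier (free_superalgebra B d)" "g \<in> carrier (free_superalgebra B d)"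
  shows "f * g \<in> carrier (free_superalgebra B d)"
  using assms keys_mult[of f g] unfolding free_carrier_iff by fastforce

lemma free_carrier_smult:
  "f \<in> carrier (free_superalgebra B d) \<Longrightarrow> nc_const c * f \<in> carrier (free_superalgebra B d)"
  unfolding free_carrier_iff using keys_nc_const_mult by blast

lemma free_abelian_group: "abelian_group (free_superalgebra B d)"
proof (rule abelian_groupI)
  fix f assume "f \<in> carrier (free_superalgebra B d)"
  then show "\<exists>g \<in> carrier (free_superalgebra B d). g \<oplus>\<^bsub>free_superalgebra B d\<^esub> f = \<zero>\<^bsub>free_superalgebra B d\<^esub>"
    by (intro bexI[of _ "- f"]) (simp_all add: free_carrier_iff)
qed (auto simp: free_carrier_add add_ac, simp add: free_carrier_iff)

lemma free_ring: "ring (free_superalgebra B d)"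
  by (rule ringI[OF free_abelian_group])
    (auto intro!: monoidI simp: free_carrier_mult mult.assoc distrib_left distrib_right,
      simp add: free_carrier_iff)

lemma free_module: "module Cq_ring (free_superalgebra B d)"
  by (rule moduleI)
    (auto simp: free_abelian_group cring_from_type_algebra free_carrier_smult nc_const_mult
      nc_const_add distrib_left distrib_right mult.assoc)

lemma free_is_superalgebra: "superalgebra Cq_ring (free_superalgebra B d)"
proof (intro superalgebra.intro superalgebra_axioms.intro free_ring free_module)
  let ?F = "free_superalgebra B d"
  interpret F: Module.module Cq_ring ?F by (rule free_module)
  show "submodule (hcomp ?F s) Cq_ring ?F" for s
  proof (rule F.submoduleI)
    show sub: "hcomp ?F s \<subseteq> carrier ?F"
      by (auto simp: free_hcomp_iff free_carrier_iff)
    show "\<ominus>\<^bsub>?F\<^esub> f \<in> hcomp ?F s" if "f \<in> hcomp ?F s" for f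
    proof -
      have "- f \<in> hcomp ?F s" using that by (simp add: free_hcomp_iff)
      moreover from this have "\<ominus>\<^bsub>?F\<^esub> f = - f"
        using that sub by (intro F.minus_equality) auto
      ultimately show ?thesis by simp
    qed
  qed (auto simp: free_hcomp_add free_hcomp_smult)
  fix f assume f: "f \<in> carrier ?F"
  let ?P = "\<lambda>(g, h). g \<in> hcomp ?F 0 \<and> h \<in> hcomp ?F 1 \<and> f = g \<oplus>\<^bsub>?F\<^esub> h"
  show "\<exists>!p. ?P p"
  proof (rule ex1I)
    have "f = nc_part d 0 f + nc_part d 1 f"
      by (rule poly_mapping_eqI) (simp add: lookup_add lookup_nc_part)
    then show "?P (nc_part d 0 f, nc_part d 1 f)"
      using f by (auto simp: free_hcomp_iff free_carrier_iff in_keys_iff lookup_nc_part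
          split: if_splits)
  next
    fix p assume "?P p"
    then obtain g h where p: "p = (g, h)" and gh: "g \<in> hcomp ?F 0" "h \<in> hcomp ?F 1" "f = g + h"
      by auto
    have part: "nc_part d s (g + h) = nc_part d s g + nc_part d s h" for s
      by (rule poly_mapping_eqI) (simp add: lookup_add lookup_nc_part)
    show "p = (nc_part d 0 f, nc_part d 1 f)"
      using gh nc_part_homogeneous[of g d 0] nc_part_homogeneous[of h d 1]
      by (simp add: p part free_hcomp_iff)
  qed
qed (auto simp: free_hcomp_mult mult.assoc nc_const_commute simp flip: mult.assoc)

section \<open>Koszul signs on words\<close>

text \<open>The sum of \<open>|x\<^sub>a| |x\<^sub>b|\<close> over all pairs of positions \<open>a < b\<close>.\<close>

fun koszul_exponent :: "('x \<Rightarrow> bit) \<Rightarrow> 'x list \<Rightarrow> bit" where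
  "koszul_exponent d [] = 0"
| "koszul_exponent d (x # xs) = d x * sum_list (map d xs) + koszul_exponent d xs"

lemma koszul_exponent_append:
  "koszul_exponent d (xs @ ys) =
    koszul_exponent d xs + koszul_exponent d ys + sum_list (map d xs) * sum_list (map d ys)"
  by (induction xs) (simp_all add: algebra_simps)

definition koszul_sign :: "('x \<Rightarrow> bit) \<Rightarrow> 'x free_monoid \<Rightarrow> Cq" where
  "koszul_sign d w = sign_of (koszul_exponent d (letters w))"

text \<open>
  The Koszul sign is a cochain with coboundary \<open>(-1)\<close> to the \<open>|v| |w|\<close>: the pairs of positions in a
  concatenation are those within each of the two words and those between them.
\<close>

lemma koszul_sign_add:
  "koszul_sign d (v + w) = koszul_sign d v * koszul_sign d w * sign_of (word_deg d v * word_deg d w)"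
  by (simp add: koszul_sign_def koszul_exponent_append sign_of_add word_deg_def)

lemma koszul_sign_simps [simp]:
  "koszul_sign d w * koszul_sign d w = 1" "koszul_sign d w \<noteq> 0"
  "koszul_sign d 0 = 1" "koszul_sign d (Word [x]) = 1"
  by (simp_all add: koszul_sign_def sign_of_def)

definition koszul_map :: "('x \<Rightarrow> bit) \<Rightarrow> 'x ncpoly \<Rightarrow> 'x ncpoly" where
  "koszul_map d f = Poly_Mapping.mapp (\<lambda>w c. koszul_sign d w * c) f"

lemma lookup_koszul_map:
  "Poly_Mapping.lookup (koszul_map d f) w = koszul_sign d w * Poly_Mapping.lookup f w"
  by (simp add: koszul_map_def lookup_mapp when_def in_keys_iff)

lemma keys_koszul_map [simp]: "Poly_Mapping.keys (koszul_map d f) = Poly_Mapping.keys f"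
  by (auto simp: in_keys_iff lookup_koszul_map)

lemma koszul_map_involution [simp]: "koszul_map d (koszul_map d f) = f"
  by (rule poly_mapping_eqI) (simp add: lookup_koszul_map flip: mult.assoc)

lemma koszul_map_linear:
  "koszul_map d (f + g) = koszul_map d f + koszul_map d g"
  "koszul_map d (f - g) = koszul_map d f - koszul_map d g"
  "koszul_map d (nc_const c * f) = nc_const c * koszul_map d f"
  by (rule poly_mapping_eqI;
      simp add: lookup_koszul_map lookup_add lookup_minus lookup_nc_const_mult algebra_simps)+

lemma koszul_map_single:
  "koszul_map d (Poly_Mapping.single w c) = Poly_Mapping.single w (koszul_sign d w * c)"
  by (rule poly_mapping_eqI) (simp add: lookup_koszul_map lookup_single when_def)

lemma koszul_map_fixes [simp]:
  "koszul_map d 0 = 0" "koszul_map d 1 = 1" "koszul_map d (nc_const c) = nc_const c"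
  "koszul_map d (nc_var x) = nc_var x"
  using koszul_map_single[of d 0 0] koszul_map_single[of d 0 1]
  by (simp_all add: koszul_map_single nc_const_def nc_var_def)

lemma koszul_map_sum: "koszul_map d (\<Sum>x \<in> I. f x) = (\<Sum>x \<in> I. koszul_map d (f x))"
  by (induction I rule: infinite_finite_induct) (simp_all add: koszul_map_linear)

lemma koszul_map_mult_homogeneous:
  assumes "f \<in> hcomp (free_superalgebra B d) s" "g \<in> hcomp (free_superalgebra B d) t"
  shows "koszul_map d (f * g) = sign_of (s * t) * (koszul_map d f * koszul_map d g)"
proof -
  let ?l = Poly_Mapping.lookup and ?k = "Poly_Mapping.keys" and ?m = "Poly_Mapping.single"
  have "koszul_map d (f * g) =
      (\<Sum>v \<in> ?k f. \<Sum>w \<in> ?k g. ?m (v + w) (koszul_sign d (v + w) * (?l f v * ?l g w)))"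
    by (simp add: ncpoly_mult_sum_monomials[of f g] koszul_map_sum koszul_map_single)
  also have "\<dots> = (\<Sum>v \<in> ?k f. \<Sum>w \<in> ?k g. nc_const (sign_of (s * t)) *
      ?m (v + w) ((koszul_sign d v * ?l f v) * (koszul_sign d w * ?l g w)))"
    using assms
    by (intro sum.cong refl)
      (auto simp: koszul_sign_add free_hcomp_iff nc_const_def mult_single intro!: arg_cong2[of _ _ _ _ "?m"])
  also have "\<dots> = nc_const (sign_of (s * t)) * (koszul_map d f * koszul_map d g)"
    by (simp add: ncpoly_mult_sum_monomials[of "koszul_map d f"] lookup_koszul_map sum_distrib_left)
  finally show ?thesis by (simp add: nc_const_sign_of)
qed

lemma koszul_twist:
  assumes "superalgebra Cq_ring A" "\<And>s t. \<zeta> s t = sign_of (s * t)"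
  shows "superalgebra_twist Cq_ring A \<zeta>"
proof (intro superalgebra_twist.intro superalgebra_twist_axioms.intro assms(1))
  have "sign_of x * sign_of x = (1::Cq)" for x by (simp add: sign_of_def)
  then show "\<zeta> s t \<in> Units Cq_ring" for s t
    unfolding Units_def assms(2) by auto
qed (simp_all add: assms(2) sign_of_def[of 0] algebra_simps flip: sign_of_add)

text \<open>Signs square to 1, so the map is its own inverse and bijectivity is immediate.\<close>

lemma koszul_map_iso:
  assumes \<zeta>: "\<And>s t. \<zeta> s t = sign_of (s * t)"
  shows "koszul_map d \<in> superalgebra_iso Cq_ring (free_superalgebra B d) (twist \<zeta> (free_superalgebra B d))"
proof -
  let ?F = "free_superalgebra B d"
  interpret F: superalgebra_twist Cq_ring ?F \<zeta>
    by (rule koszul_twist[OF free_is_superalgebra \<zeta>])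
  have closed: "koszul_map d f \<in> carrier ?F" if "f \<in> carrier ?F" for f
    using that by (simp add: free_carrier_iff)
  have mult: "koszul_map d (f * g) = koszul_map d f \<otimes>\<^bsub>F.T\<^esub> koszul_map d g"
    if "f \<in> carrier ?F" "g \<in> carrier ?F" for f g
    using that(1)
  proof (induction rule: F.homogeneous_induct)
    case (homogeneous s f)
    from that(2) show ?case
    proof (induction rule: F.homogeneous_induct)
      case (homogeneous t g)
      have "koszul_map d f \<in> hcomp ?F s" "koszul_map d g \<in> hcomp ?F t"
        using homogeneous \<open>f \<in> hcomp ?F s\<close> by (simp_all add: free_hcomp_iff)
      from F.twist_mult_homogeneous[OF this] show ?case
        using koszul_map_mult_homogeneous[OF \<open>f \<in> hcomp ?F s\<close> homogeneous]
        by (simp add: \<zeta>[of s t] nc_const_sign_of)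
    next
      case (add g h)
      then show ?case
        using F.twist_r_distr[of "koszul_map d g" "koszul_map d h" "koszul_map d f"]
          closed F.hcomp_closed[OF homogeneous]
        by (simp add: distrib_left koszul_map_linear)
    qed
  next
    case (add f h)
    then show ?case
      using F.twist_l_distr[of "koszul_map d f" "koszul_map d h" "koszul_map d g"] closed that(2)
      by (simp add: distrib_right koszul_map_linear)
  qed
  have "koszul_map d \<in> ring_hom ?F F.T"
    by (rule ring_hom_memI) (simp_all add: closed mult koszul_map_linear)
  moreover have "bij_betw (koszul_map d) (carrier ?F) (carrier F.T)"
    by (rule bij_betw_byWitness[of _ "koszul_map d"]) (auto simp: closed)
  moreover have "koszul_map d ` hcomp ?F s \<subseteq> hcomp F.T s" for s
    by (auto simp: free_hcomp_iff)
  ultimately show ?thesis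
    unfolding superalgebra_iso_def
    using free_is_superalgebra F.twist_is_superalgebra by (simp add: koszul_map_linear)
qed

section \<open>The RLL relations\<close>

text \<open>
  The relation says that \<open>x\<close> is an even tensor and that \<open>y\<close> arises from it by applying the Koszul map
  to the coefficients. Stated as a relation on the range \<open>{1..N}\<close>, outside of which the values of a
  tensor are arbitrary, it propagates through iterated products.
\<close>

definition koszul_related :: "nat \<Rightarrow> (nat \<Rightarrow> bit) \<Rightarrow> RLL_letter ncpoly tens \<Rightarrow> RLL_letter ncpoly tens \<Rightarrow> bool" where
  "koszul_related N par x y \<longleftrightarrow> (\<forall>i \<in> {1..N}. \<forall>j \<in> {1..N}. \<forall>k \<in> {1..N}. \<forall>l \<in> {1..N}.
     x i j k l \<in> hcomp (free_RLL N par) (par i + par j + par k + par l) \<and>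
     y i j k l = koszul_map (letter_par par) (x i j k l))"

lemma koszul_relatedD:
  assumes "koszul_related N par x y" "{i, j, k, l} \<subseteq> {1..N}"
  shows "x i j k l \<in> hcomp (free_RLL N par) (par i + par j + par k + par l)"
    "y i j k l = koszul_map (letter_par par) (x i j k l)"
  using assms unfolding koszul_related_def by auto

text \<open>
  When each coefficient of the second factor is homogeneous, only one of the two summands over its
  parity survives.
\<close>

lemma tens_mult_homogeneous:
  assumes y: "\<And>u v. \<lbrakk>u \<in> {1..N}; v \<in> {1..N}\<rbrakk>
    \<Longrightarrow> y u j v l \<in> hcomp (free_RLL N par) (par u + par j + par v + par l)"
  shows "tens_mult \<beta> N par x y i j k l =
    (\<Sum>u = 1..N. \<Sum>v = 1..N.
       of_int (\<beta> (E_deg par i u) (par u + par j + par v + par l, 0)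
         * \<beta> (E_deg par k v) (par u + par j + par v + par l, 0)
         * \<beta> (E_deg par k v) (E_deg par u j)) * (x i u k v * y u j v l))"
  unfolding tens_mult_def
proof (intro sum.cong refl)
  fix u v assume "u \<in> {1..N}" "v \<in> {1..N}"
  note h = y[OF this, unfolded free_RLL_def free_hcomp_iff]
  let ?t = "par u + par j + par v + par l"
  have part: "nc_part (letter_par par) s (y u j v l) = (if s = ?t then y u j v l else 0)" for s
    using h by (intro nc_part_homogeneous) blast
  show "(\<Sum>s \<in> {0, 1}. of_int (\<beta> (E_deg par i u) (s, 0) * \<beta> (E_deg par k v) (s, 0)
      * \<beta> (E_deg par k v) (E_deg par u j)) * (x i u k v * nc_part (letter_par par) s (y u j v l)))
    = of_int (\<beta> (E_deg par i u) (?t, 0) * \<beta> (E_deg par k v) (?t, 0)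
      * \<beta> (E_deg par k v) (E_deg par u j)) * (x i u k v * y u j v l)"
    by (cases ?t) (simp_all add: part)
qed

text \<open>
  At \<open>E\<^sub>i\<^sub>u E\<^sub>u\<^sub>j \<otimes> E\<^sub>k\<^sub>v E\<^sub>v\<^sub>l\<close> the exponent of the sign is \<open>?e'\<close> for \<open>\<beta>'\<close>, coming only from the two
  matrix factors, and \<open>?e\<close> for \<open>\<beta>\<close>. By evenness their difference is the product of the parities
  \<open>?s\<close> and \<open>?t\<close> of the two coefficients, and so it is absorbed by the Koszul map.
\<close>

lemma koszul_related_tens_mult:
  assumes x: "koszul_related N par x x'" and y: "koszul_related N par y y'"
  shows "koszul_related N par (tens_mult beta' N par x y) (tens_mult beta N par x' y')"
  unfolding koszul_related_def
proof (intro ballI conjI)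
  fix i j k l assume ix: "i \<in> {1..N}" "j \<in> {1..N}" "k \<in> {1..N}" "l \<in> {1..N}"
  let ?K = "koszul_map (letter_par par)" and ?F = "free_RLL N par"
  let ?s = "\<lambda>u v. par i + par u + par k + par v" and ?t = "\<lambda>u v. par u + par j + par v + par l"
  let ?e' = "\<lambda>u v. (par k + par v) * (par u + par j)"
  let ?e = "\<lambda>u v. ?e' u v + ?s u v * ?t u v"
  have xD: "x i u k v \<in> hcomp ?F (?s u v)" "x' i u k v = ?K (x i u k v)"
    and yD: "y u j v l \<in> hcomp ?F (?t u v)" "y' u j v l = ?K (y u j v l)"
    if "u \<in> {1..N}" "v \<in> {1..N}" for u v
    using koszul_relatedD[OF x, of i u k v] koszul_relatedD[OF y, of u j v l] that ix by auto
  have y'h: "y' u j v l \<in> hcomp ?F (?t u v)" if "u \<in> {1..N}" "v \<in> {1..N}" for u v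
    using yD[OF that] by (simp add: free_RLL_def free_hcomp_iff)
  have b': "beta' (E_deg par i u) (?t u v, 0) * beta' (E_deg par k v) (?t u v, 0)
      * beta' (E_deg par k v) (E_deg par u j) = sign_of (?e' u v)" for u v
    by (simp add: beta'_def E_deg_def sign_of_def[of 0])
  have b: "beta (E_deg par i u) (?t u v, 0) * beta (E_deg par k v) (?t u v, 0)
      * beta (E_deg par k v) (E_deg par u j) = sign_of (?e u v)" for u v
  proof -
    have "beta (E_deg par i u) (?t u v, 0) * beta (E_deg par k v) (?t u v, 0)
        * beta (E_deg par k v) (E_deg par u j)
      = sign_of ((par i + par u) * ?t u v + (par k + par v) * ?t u v + ?e' u v)"
      by (simp only: beta_def E_deg_def fst_conv snd_conv add_0 add_0_right sign_of_add)
    also have "(par i + par u) * ?t u v + (par k + par v) * ?t u v + ?e' u v = ?e u v"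
      by (simp only: distrib_right add_ac)
    finally show ?thesis .
  qed
  have prod: "tens_mult beta' N par x y i j k l =
      (\<Sum>u = 1..N. \<Sum>v = 1..N. sign_of (?e' u v) * (x i u k v * y u j v l))"
    by (subst tens_mult_homogeneous) (simp_all add: yD b' of_int_sign_of)
  have "x i u k v * y u j v l \<in> hcomp ?F (par i + par j + par k + par l)"
    if "u \<in> {1..N}" "v \<in> {1..N}" for u v
  proof -
    have "?s u v + ?t u v = par i + par j + par k + par l"
      by (cases "par u"; cases "par v"; simp add: add_ac)
    then show ?thesis
      using free_hcomp_mult[of "x i u k v" _ _ "?s u v" "y u j v l" "?t u v"] xD(1)[OF that] yD(1)[OF that]
      unfolding free_RLL_def by metis
  qed
  then show "tens_mult beta' N par x y i j k l \<in> hcomp ?F (par i + par j + par k + par l)"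
    unfolding prod free_RLL_def by (intro free_hcomp_sum free_hcomp_sign)
  have "?K (tens_mult beta' N par x y i j k l) =
      (\<Sum>u = 1..N. \<Sum>v = 1..N. sign_of (?e' u v) * ?K (x i u k v * y u j v l))"
    unfolding prod
    by (simp add: koszul_map_sum koszul_map_linear(3) flip: nc_const_sign_of)
  also have "\<dots> = (\<Sum>u = 1..N. \<Sum>v = 1..N. sign_of (?e u v) * (x' i u k v * y' u j v l))"
  proof (intro sum.cong refl)
    fix u v assume uv: "u \<in> {1..N}" "v \<in> {1..N}"
    have "?K (x i u k v * y u j v l) = sign_of (?s u v * ?t u v) * (x' i u k v * y' u j v l)"
      using koszul_map_mult_homogeneous[OF xD(1)[OF uv, unfolded free_RLL_def]
          yD(1)[OF uv, unfolded free_RLL_def]] xD(2)[OF uv] yD(2)[OF uv] by simp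
    then show "sign_of (?e' u v) * ?K (x i u k v * y u j v l)
        = sign_of (?e u v) * (x' i u k v * y' u j v l)"
      by (simp only: sign_of_add mult.assoc)
  qed
  also have "\<dots> = tens_mult beta N par x' y' i j k l"
    by (subst tens_mult_homogeneous) (simp_all add: y'h b of_int_sign_of)
  finally show "tens_mult beta N par x' y' i j k l = ?K (tens_mult beta' N par x y i j k l)" ..
qed

lemma l_gen_hcomp: "l_gen N e i j \<in> hcomp (free_RLL N par) (par i + par j)"
  by (simp add: l_gen_def nc_var_def free_RLL_def free_hcomp_iff word_deg_def)

lemma koszul_map_l_gen [simp]: "koszul_map d (l_gen N e i j) = l_gen N e i j"
  by (simp add: l_gen_def)

text \<open>
  The coefficients of \<open>R\<close> are scalars, so evenness means that \<open>R\<close> is supported on even tensors of matrix units: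
  it contains only \<open>E\<^sub>i\<^sub>i \<otimes> E\<^sub>k\<^sub>k\<close> and \<open>E\<^sub>i\<^sub>j \<otimes> E\<^sub>j\<^sub>i\<close>.
\<close>

lemma koszul_related_R12: "koszul_related N par (R12 par) (R12 par)"
proof -
  have "R12 par i j k l \<in> hcomp (free_RLL N par) (par i + par j + par k + par l)" for i j k l
  proof (cases "par i + par j + par k + par l = 0")
    case True
    then show ?thesis unfolding R12_def free_RLL_def using nc_const_hcomp by simp
  next
    case False
    then have "\<not> (i = j \<and> k = l)" "\<not> (k = j \<and> l = i)"
      by (auto simp: bit_cancel)
    then have "R_matrix par i j k l = 0" unfolding R_matrix_def by auto
    then show ?thesis by (simp add: R12_def free_RLL_def nc_const_def)
  qed
  then show ?thesis by (simp add: koszul_related_def R12_def)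
qed

lemma koszul_related_L1: "koszul_related N par (L1 N e) (L1 N e)"
  using l_gen_hcomp[of N e _ _ par]
  by (simp add: koszul_related_def L1_def bit_cancel) (simp add: free_RLL_def)

lemma koszul_related_L2: "koszul_related N par (L2 N e) (L2 N e)"
  using l_gen_hcomp[of N e _ _ par]
  by (simp add: koszul_related_def L2_def bit_cancel) (simp add: free_RLL_def)

definition RLL_entry :: "bichar \<Rightarrow> nat \<Rightarrow> (nat \<Rightarrow> bit) \<Rightarrow> pm \<Rightarrow> pm \<Rightarrow> RLL_letter ncpoly tens" where
  "RLL_entry \<beta> N par e e' i j k l =
     tens_mult \<beta> N par (tens_mult \<beta> N par (R12 par) (L1 N e)) (L2 N e') i j k l
     - tens_mult \<beta> N par (tens_mult \<beta> N par (L2 N e') (L1 N e)) (R12 par) i j k l"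

lemma RLL_entry_koszul:
  assumes "{i, j, k, l} \<subseteq> {1..N}"
  shows "RLL_entry beta' N par e e' i j k l \<in> hcomp (free_RLL N par) (par i + par j + par k + par l)"
    "koszul_map (letter_par par) (RLL_entry beta' N par e e' i j k l) = RLL_entry beta N par e e' i j k l"
proof -
  have "koszul_related N par
      (tens_mult beta' N par (tens_mult beta' N par (R12 par) (L1 N e)) (L2 N e'))
      (tens_mult beta N par (tens_mult beta N par (R12 par) (L1 N e)) (L2 N e'))"
    "koszul_related N par
      (tens_mult beta' N par (tens_mult beta' N par (L2 N e') (L1 N e)) (R12 par))
      (tens_mult beta N par (tens_mult beta N par (L2 N e') (L1 N e)) (R12 par))"
    by (intro koszul_related_tens_mult koszul_related_R12 koszul_related_L1 koszul_related_L2)+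
  note r = koszul_relatedD[OF this(1) assms] koszul_relatedD[OF this(2) assms]
  show "RLL_entry beta' N par e e' i j k l \<in> hcomp (free_RLL N par) (par i + par j + par k + par l)"
    using r(1,3) unfolding RLL_entry_def free_RLL_def by (rule free_hcomp_diff)
  show "koszul_map (letter_par par) (RLL_entry beta' N par e e' i j k l) = RLL_entry beta N par e e' i j k l"
    using r(2,4) by (simp add: RLL_entry_def koszul_map_linear)
qed

definition diagonal_relation :: "nat \<Rightarrow> pm \<Rightarrow> pm \<Rightarrow> nat \<Rightarrow> RLL_letter ncpoly" where
  "diagonal_relation N e e' i = l_gen N e i i * l_gen N e' i i - 1"

lemma diagonal_relation_koszul:
  "diagonal_relation N e e' i \<in> hcomp (free_RLL N par) 0"
  "koszul_map (letter_par par) (diagonal_relation N e e' i) = diagonal_relation N e e' i"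
proof -
  have l: "l_gen N e i i \<in> hcomp (free_superalgebra (RLL_letters N) (letter_par par)) 0" for e
    using l_gen_hcomp[of N e i i par] by (simp add: free_RLL_def bit_cancel)
  show "diagonal_relation N e e' i \<in> hcomp (free_RLL N par) 0"
    unfolding diagonal_relation_def free_RLL_def
    using free_hcomp_mult[OF l l, of e e'] nc_const_hcomp[of 1]
    by (intro free_hcomp_diff) simp_all
  show "koszul_map (letter_par par) (diagonal_relation N e e' i) = diagonal_relation N e e' i"
    using koszul_map_mult_homogeneous[OF l l, of e e']
    by (simp add: diagonal_relation_def koszul_map_linear sign_of_def)
qed

lemma RLL_relations_cases:
  "t \<in> RLL_relations \<beta> N par \<longleftrightarrow>
     (\<exists>i \<in> {1..N}. t = diagonal_relation N Plus Minus i) \<or>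
     (\<exists>i \<in> {1..N}. t = diagonal_relation N Minus Plus i) \<or>
     (\<exists>e e' i j k l. (e, e') \<in> {(Plus, Plus), (Minus, Minus), (Plus, Minus)} \<and>
        {i, j, k, l} \<subseteq> {1..N} \<and> t = RLL_entry \<beta> N par e e' i j k l)"
  unfolding RLL_relations_def diagonal_relation_def RLL_entry_def Un_iff mem_Collect_eq
  by (simp only: Bex_def conj_ac disj_assoc)

lemma RLL_relations_homogeneous:
  "RLL_relations beta' N par \<subseteq> (\<Union>s. hcomp (free_RLL N par) s)"
proof
  fix t assume "t \<in> RLL_relations beta' N par"
  then show "t \<in> (\<Union>s. hcomp (free_RLL N par) s)"
    unfolding RLL_relations_cases UN_iff
    using diagonal_relation_koszul(1) RLL_entry_koszul(1) by (metis UNIV_I)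
qed

lemma koszul_map_RLL_relations:
  "koszul_map (letter_par par) ` RLL_relations beta' N par = RLL_relations beta N par"
proof (intro equalityI subsetI)
  fix t assume "t \<in> koszul_map (letter_par par) ` RLL_relations beta' N par"
  then obtain r where r: "r \<in> RLL_relations beta' N par" "t = koszul_map (letter_par par) r" by blast
  then show "t \<in> RLL_relations beta N par"
    unfolding RLL_relations_cases using diagonal_relation_koszul(2) RLL_entry_koszul(2) by metis
next
  fix t assume t: "t \<in> RLL_relations beta N par"
  have "koszul_map (letter_par par) t \<in> RLL_relations beta' N par"
    using t unfolding RLL_relations_cases
    using diagonal_relation_koszul(2) RLL_entry_koszul(2) koszul_map_involution by metis
  then show "t \<in> koszul_map (letter_par par) ` RLL_relations beta' N par"
    using koszul_map_involution by (metis image_eqI)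
qed

theorem proposition3p51:
  fixes m n :: nat and par :: "nat \<Rightarrow> bit" and \<zeta> :: "bit \<Rightarrow> bit \<Rightarrow> Cq"
  assumes "card {i \<in> {1..m + n}. par i = 0} = m"
    and "card {i \<in> {1..m + n}. par i = 1} = n"
    and "\<And>s t. \<zeta> s t = sign_of (s * t)"
  shows "\<exists>f \<in> superalgebra_iso Cq_ring (U_R_tilde (m + n) par) (twist \<zeta> (U_R (m + n) par)).
    \<forall>e. \<forall>i \<in> {1..m + n}. \<forall>j \<in> {1..m + n}.
      f (RLL_gen beta' (m + n) par e i j) = RLL_gen beta (m + n) par e i j"
proof -
  let ?N = "m + n" and ?K = "koszul_map (letter_par par)"
  have twist: "superalgebra_twist Cq_ring (free_RLL ?N par) \<zeta>"
    unfolding free_RLL_def by (rule koszul_twist[OF free_is_superalgebra assms(3)])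
  have iso: "?K \<in> superalgebra_iso Cq_ring (free_RLL ?N par) (twist \<zeta> (free_RLL ?N par))"
    unfolding free_RLL_def by (rule koszul_map_iso[OF assms(3)])
  note quotient = quotient_twist_iso[OF twist iso RLL_relations_homogeneous,
      unfolded koszul_map_RLL_relations]
  show ?thesis
  proof (intro bexI[of _ "(`) ?K"] allI ballI)
    show "(`) ?K \<in> superalgebra_iso Cq_ring (U_R_tilde ?N par) (twist \<zeta> (U_R ?N par))"
      using quotient(1) by (simp add: RLL_def RLL_ideal_def)
    fix e i j
    have "l_gen ?N e i j \<in> carrier (free_RLL ?N par)"
      using l_gen_hcomp[of ?N e i j par] by (simp add: free_RLL_def free_hcomp_iff free_carrier_iff)
    from quotient(2)[OF this]
    show "?K ` RLL_gen beta' ?N par e i j = RLL_gen beta ?N par e i j"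
      by (simp add: RLL_gen_def RLL_ideal_def)
  qed
qed

end
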